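(* Denote by $H(\mathbb{Z})$ the subgroup of $SL_3(\mathbb{Z})$ consisting of all upper-triangular matrices. Then $\mathbb{Z}^3\rtimes H(\mathbb{Z})$ is a maximal Haagerup subgroup of $\mathbb{Z}^3\rtimes SL_3(\mathbb{Z})$.
   Context: $SL_3(\mathbb{Z})$ acts on $\mathbb{Z}^3$ by matrix multiplication. A (discrete countable) group $G$ has the Haagerup property if there is a sequence of positive-definite functions in $c_0(G)$ converging pointwise to $1$. A maximal Haagerup subgroup of $G$ is a subgroup of $G$ with the Haagerup property that is not properly contained in any other subgroup of $G$ with the Haagerup property. *)

theory Defs
  imports "HOL-Analysis.Analysis" "HOL-Algebra.Group"
begin

definition positive_definite :: "('a, 'b) monoid_scheme \<Rightarrow> ('a \<Rightarrow> complex) \<Rightarrow> bool"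
  where "positive_definite G \<phi> \<longleftrightarrow>
    (\<forall>(n::nat) (g :: nat \<Rightarrow> 'a) (c :: nat \<Rightarrow> complex). (\<forall>i<n. g i \<in> carrier G) \<longrightarrow>
       (\<Sum>i<n. \<Sum>j<n. cnj (c i) * c j * \<phi> (inv\<^bsub>G\<^esub> (g i) \<otimes>\<^bsub>G\<^esub> g j)) \<in> \<real>\<^sub>\<ge>\<^sub>0)"

(* c_0(G) for the discrete topology on G; values outside the carrier are ignored *)
definition c0_on :: "'a set \<Rightarrow> ('a \<Rightarrow> complex) \<Rightarrow> bool"
  where "c0_on S \<phi> \<longleftrightarrow> (\<forall>\<epsilon>>0. finite {g \<in> S. cmod (\<phi> g) \<ge> \<epsilon>})"

definition haagerup_property :: "('a, 'b) monoid_scheme \<Rightarrow> bool"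
  where "haagerup_property G \<longleftrightarrow>
    group G \<and> countable (carrier G) \<and>
    (\<exists>\<phi> :: nat \<Rightarrow> 'a \<Rightarrow> complex.
       (\<forall>n. positive_definite G (\<phi> n) \<and> c0_on (carrier G) (\<phi> n)) \<and>
       (\<forall>g\<in>carrier G. (\<lambda>n. \<phi> n g) \<longlonglongrightarrow> 1))"

definition haagerup_subgroup :: "'a set \<Rightarrow> ('a, 'b) monoid_scheme \<Rightarrow> bool"
  where "haagerup_subgroup H G \<longleftrightarrow> subgroup H G \<and> haagerup_property (G\<lparr>carrier := H\<rparr>)"

definition maximal_haagerup_subgroup :: "'a set \<Rightarrow> ('a, 'b) monoid_scheme \<Rightarrow> bool"
  where "maximal_haagerup_subgroup H G \<longleftrightarrow>
    haagerup_subgroup H G \<and> \<not> (\<exists>K. haagerup_subgroup K G \<and> H \<subset> K)"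

(* N \<rtimes> K, where k \<in> K acts on N by the automorphism \<alpha> k *)
definition semidirect_product ::
    "('n, 'p) monoid_scheme \<Rightarrow> ('k, 'q) monoid_scheme \<Rightarrow> ('k \<Rightarrow> 'n \<Rightarrow> 'n) \<Rightarrow> ('n \<times> 'k) monoid"
  where "semidirect_product N K \<alpha> =
    \<lparr>carrier = carrier N \<times> carrier K,
     mult = (\<lambda>(v, A) (w, B). (v \<otimes>\<^bsub>N\<^esub> \<alpha> A w, A \<otimes>\<^bsub>K\<^esub> B)),
     one = (\<one>\<^bsub>N\<^esub>, \<one>\<^bsub>K\<^esub>)\<rparr>"

definition Z3 :: "(int ^ 3) monoid"
  where "Z3 = \<lparr>carrier = UNIV, mult = (+), one = 0\<rparr>"

definition SL3Z :: "(int ^ 3 ^ 3) monoid"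
  where "SL3Z = \<lparr>carrier = {A. det A = 1}, mult = (**), one = mat 1\<rparr>"

(* The below-diagonal entries are listed explicitly because 3 = 0 in the index type 3, so that the
   order of that type is 3 < 1 < 2 and not the order of rows and columns meant here.
   The diagonal entries range over all \<plusminus>1 compatible with determinant 1. *)
definition upper_triangular_SL3Z :: "(int ^ 3 ^ 3) set"
  where "upper_triangular_SL3Z = {A \<in> carrier SL3Z. A $ 2 $ 1 = 0 \<and> A $ 3 $ 1 = 0 \<and> A $ 3 $ 2 = 0}"

lemma ex_inv_SL3Z:
  fixes A :: "int ^ 3 ^ 3"
  assumes "det A = 1"
  shows "\<exists>B. det B = 1 \<and> B ** A = mat 1 \<and>
    (A \<in> upper_triangular_SL3Z \<longrightarrow> B \<in> upper_triangular_SL3Z)"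
proof -
  define B :: "int ^ 3 ^ 3" where "B = vector [
    vector [A$2$2*A$3$3 - A$2$3*A$3$2, A$1$3*A$3$2 - A$1$2*A$3$3, A$1$2*A$2$3 - A$1$3*A$2$2],
    vector [A$2$3*A$3$1 - A$2$1*A$3$3, A$1$1*A$3$3 - A$1$3*A$3$1, A$1$3*A$2$1 - A$1$1*A$2$3],
    vector [A$2$1*A$3$2 - A$2$2*A$3$1, A$1$2*A$3$1 - A$1$1*A$3$2, A$1$1*A$2$2 - A$1$2*A$2$1]]"
  have d: "A$1$1*A$2$2*A$3$3 + A$1$2*A$2$3*A$3$1 + A$1$3*A$2$1*A$3$2
      - A$1$1*A$2$3*A$3$2 - A$1$2*A$2$1*A$3$3 - A$1$3*A$2$2*A$3$1 = 1"
    using assms by (simp add: det_3)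
  have BA: "B ** A = mat 1"
    unfolding vec_eq_iff forall_3 matrix_matrix_mult_def mat_def B_def
    using d by (simp add: sum_3 algebra_simps)
  then have "det B * det A = 1" by (metis det_mul det_I)
  then have "det B = 1" using assms by simp
  moreover have "B \<in> upper_triangular_SL3Z" if "A \<in> upper_triangular_SL3Z"
    using that \<open>det B = 1\<close> by (simp add: upper_triangular_SL3Z_def SL3Z_def B_def)
  ultimately show ?thesis using BA by blast
qed

lemma group_SL3Z: "group SL3Z"
proof (rule groupI)
  fix A assume "A \<in> carrier SL3Z"
  then show "\<exists>B\<in>carrier SL3Z. B \<otimes>\<^bsub>SL3Z\<^esub> A = \<one>\<^bsub>SL3Z\<^esub>"
    using ex_inv_SL3Z[of A] by (auto simp: SL3Z_def)
qed (auto simp: SL3Z_def det_mul matrix_mul_assoc)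

lemma subgroup_upper_triangular_SL3Z: "subgroup upper_triangular_SL3Z SL3Z"
proof (rule group.subgroupI[OF group_SL3Z])
  show "upper_triangular_SL3Z \<subseteq> carrier SL3Z"
    by (auto simp: upper_triangular_SL3Z_def)
  have "mat 1 \<in> upper_triangular_SL3Z"
    by (simp add: upper_triangular_SL3Z_def SL3Z_def mat_def) (simp add: det_3)
  then show "upper_triangular_SL3Z \<noteq> {}" by blast
  fix A assume A: "A \<in> upper_triangular_SL3Z"
  then have "A \<in> carrier SL3Z" "det A = 1" by (auto simp: upper_triangular_SL3Z_def SL3Z_def)
  then obtain B where B: "det B = 1" "B ** A = mat 1" "B \<in> upper_triangular_SL3Z"
    using ex_inv_SL3Z A by blast
  have "inv\<^bsub>SL3Z\<^esub> A = B"
    by (rule group.inv_equality[OF group_SL3Z])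
       (use B \<open>A \<in> carrier SL3Z\<close> in \<open>auto simp: SL3Z_def\<close>)
  then show "inv\<^bsub>SL3Z\<^esub> A \<in> upper_triangular_SL3Z" using B by simp
  fix C assume "C \<in> upper_triangular_SL3Z"
  with A show "A \<otimes>\<^bsub>SL3Z\<^esub> C \<in> upper_triangular_SL3Z"
    by (simp add: upper_triangular_SL3Z_def SL3Z_def det_mul)
       (simp add: matrix_matrix_mult_def sum_3)
qed

lemma group_Z3_SL3Z: "group (semidirect_product Z3 SL3Z matrix_vector_mult)"
proof (rule groupI)
  fix x assume "x \<in> carrier (semidirect_product Z3 SL3Z matrix_vector_mult)"
  then obtain v A where x: "x = (v, A)" "det A = 1"
    by (cases x) (auto simp: semidirect_product_def SL3Z_def)
  then obtain B where "det B = 1" "B ** A = mat 1" using ex_inv_SL3Z by blast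
  with x show "\<exists>y\<in>carrier (semidirect_product Z3 SL3Z matrix_vector_mult).
      y \<otimes>\<^bsub>semidirect_product Z3 SL3Z matrix_vector_mult\<^esub> x = \<one>\<^bsub>semidirect_product Z3 SL3Z matrix_vector_mult\<^esub>"
    by (intro bexI[of _ "(- (B *v v), B)"]) (auto simp: semidirect_product_def Z3_def SL3Z_def)
qed (auto simp: semidirect_product_def Z3_def SL3Z_def det_mul matrix_mul_assoc
       matrix_vector_right_distrib matrix_vector_mul_assoc)

end

theory Submission
  imports Defs "HOL-Real_Asymp.Real_Asymp"
begin

text \<open>The group \<open>\<int>\<^sup>3 \<rtimes> H(\<int>)\<close> is virtually nilpotent; boxes adapted to its lower central series are Folner
  sets, and their normalized correlation functions are finitely supported, positive definite and converge
  to \<open>1\<close>.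

  For maximality, let \<open>K\<close> be a larger subgroup with the Haagerup property and \<open>A\<close> a matrix occurring in \<open>K\<close>
  that is not upper triangular. Restricted to \<open>\<int>\<^sup>3\<close>, the positive definite functions of a Haagerup sequence
  are Fourier transforms of measures on the dual torus that concentrate at \<open>0\<close> and are almost invariant under
  the action of the matrices occurring in \<open>K\<close> on row vectors, but have no atom at \<open>0\<close>. A shear adding
  multiples of the coordinate \<open>\<theta> i\<close> to \<open>\<theta> d\<close> moves any region \<open>\<bar>\<theta> d\<bar> \<le> R \<bar>\<theta> i\<bar>\<close> near \<open>0\<close> to many disjoint
  regions, so that it has small measure. As the unipotent upper triangular matrices provide these shears, the
  measures live near one coordinate axis. But \<open>A\<close> moves this axis into a region of small measure, which is a
  contradiction. The regions are replaced by trigonometric polynomials, so that only finite sums of values of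
  the positive definite functions occur.\<close>

section \<open>Haagerup property from Folner sets\<close>

text \<open>Two limits occur that cannot be interchanged: in the index n of the Haagerup sequence,
  and in the exponent K of \<open>(1 - total_weight I \<theta>) ^ K\<close>. Decay at infinity makes
  the mean of this power small for each fixed n, but only for some K depending on n. Hence every
  bound for the complementary function \<open>1 - (1 - total_weight I \<theta>) ^ K\<close> has to
  be uniform in K. The slopes are built for this: they are polynomial versions of quotients of
  squared distances, and their sum over \<open>I\<close> is exactly that function. The constants are
  chosen in the order C (from A alone), m (the number of shears, large compared with C), n, and
  finally K. Almost invariance is needed only as a one-sided inequality with the factor 2, since a
  fixed factor is absorbed by the choice of m. Upper triangular shears add earlier angles to later
  ones only, so the exceptional axis is the last one among the coordinates in \<open>I\<close>; this
  is why \<open>I\<close> and \<open>d\<close> stay variable until the end.\<close>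

lemma haagerup_property_Folner:
  fixes G (structure) and F :: "nat \<Rightarrow> 'a set"
  assumes "group G" and "countable (carrier G)"
    and F: "\<And>n. F n \<subseteq> carrier G" "\<And>n. finite (F n)"
    and lim: "\<And>g. g \<in> carrier G \<Longrightarrow>
      (\<lambda>n. real (card {x \<in> F n. g \<otimes> x \<in> F n}) / real (card (F n))) \<longlonglongrightarrow> 1"
  shows "haagerup_property G"
proof -
  interpret group G by fact
  \<comment> \<open>Up to normalization, the coefficient of the left regular representation at the
    indicator function of \<open>F n\<close>. So positive definiteness becomes a sum of squares, and
    the support lies in the finite set of quotients of elements of \<open>F n\<close>.\<close>
  define \<phi> where "\<phi> n g = complex_of_real (real (card {x \<in> F n. g \<otimes> x \<in> F n}) / real (card (F n)))" for n g
  have "positive_definite G (\<phi> n)" for n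
    unfolding positive_definite_def
  proof (intro allI impI)
    fix N :: nat and g :: "nat \<Rightarrow> 'a" and c :: "nat \<Rightarrow> complex"
    assume g: "\<forall>i<N. g i \<in> carrier G"
    \<comment> \<open>On the carrier, \<open>e i\<close> is the indicator function of the translate
      of \<open>F n\<close> by \<open>g i\<close>. \<open>T\<close> contains all these translates,
      so sums over \<open>T\<close> are full inner products.\<close>
    define T where "T = (\<Union>i<N. (\<lambda>x. g i \<otimes> x) ` F n)"
    define e :: "nat \<Rightarrow> 'a \<Rightarrow> complex" where "e i y = of_bool (inv (g i) \<otimes> y \<in> F n)" for i y
    have T: "finite T" "T \<subseteq> carrier G"
      using F g by (auto simp: T_def) blast
    have cnj_e: "cnj (e i y) = e i y" for i y by (simp add: e_def)
    have translate: "\<phi> n (inv (g i) \<otimes> g j) = (\<Sum>y\<in>T. e i y * e j y) / of_nat (card (F n))"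
      if "i < N" "j < N" for i j
    proof -
      have gij: "g i \<in> carrier G" "g j \<in> carrier G" using that g by auto
      have cancel: "inv (g i) \<otimes> g j \<otimes> (inv (g j) \<otimes> y) = inv (g i) \<otimes> y"
        "g j \<otimes> (inv (g j) \<otimes> y) = y" "inv (g j) \<otimes> (g j \<otimes> y) = y"
        "inv (g i) \<otimes> (g j \<otimes> y) = inv (g i) \<otimes> g j \<otimes> y" if "y \<in> carrier G" for y
        using gij that by (simp_all add: m_assoc, simp_all add: m_assoc[symmetric])
      have "card {x \<in> F n. inv (g i) \<otimes> g j \<otimes> x \<in> F n}
          = card {y \<in> T. inv (g i) \<otimes> y \<in> F n \<and> inv (g j) \<otimes> y \<in> F n}"
      proof (rule bij_betw_same_card)
        have "\<And>y. y \<in> T \<Longrightarrow> y \<in> carrier G" "\<And>y. y \<in> F n \<Longrightarrow> y \<in> carrier G"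
          "\<And>y. y \<in> F n \<Longrightarrow> g j \<otimes> y \<in> T"
          using T(2) F(1)[of n] \<open>j < N\<close> by (auto simp: T_def)
        then show "bij_betw (\<lambda>x. g j \<otimes> x) {x \<in> F n. inv (g i) \<otimes> g j \<otimes> x \<in> F n}
            {y \<in> T. inv (g i) \<otimes> y \<in> F n \<and> inv (g j) \<otimes> y \<in> F n}"
          by (intro bij_betwI[where g = "\<lambda>y. inv (g j) \<otimes> y"]) (auto simp: cancel)
      qed
      also have "of_nat \<dots> = (\<Sum>y\<in>T. e i y * e j y)"
        using T by (simp add: e_def of_bool_conj[symmetric] sum_of_bool_eq Int_def)
      finally show ?thesis by (simp add: \<phi>_def)
    qed
    have "(\<Sum>i<N. \<Sum>j<N. cnj (c i) * c j * \<phi> n (inv (g i) \<otimes> g j))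
        = (\<Sum>i<N. \<Sum>j<N. \<Sum>y\<in>T. cnj (c i * e i y) * (c j * e j y)) / of_nat (card (F n))"
      by (simp add: translate sum_divide_distrib sum_distrib_left cnj_e mult_ac)
    also have "(\<Sum>i<N. \<Sum>j<N. \<Sum>y\<in>T. cnj (c i * e i y) * (c j * e j y))
        = (\<Sum>y\<in>T. \<Sum>i<N. \<Sum>j<N. cnj (c i * e i y) * (c j * e j y))"
      by (subst sum.swap, rule sum.cong[OF refl], subst sum.swap) (rule refl)
    also have "\<dots> = (\<Sum>y\<in>T. cnj (\<Sum>i<N. c i * e i y) * (\<Sum>i<N. c i * e i y))"
      by (simp add: sum_product)
    also have "\<dots> = complex_of_real (\<Sum>y\<in>T. (cmod (\<Sum>i<N. c i * e i y))\<^sup>2)"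
      by (simp add: complex_norm_square mult.commute flip: of_real_power)
    also have "\<dots> / of_nat (card (F n))
        = complex_of_real ((\<Sum>y\<in>T. (cmod (\<Sum>i<N. c i * e i y))\<^sup>2) / real (card (F n)))"
      by simp
    also have "\<dots> \<in> \<real>\<^sub>\<ge>\<^sub>0"
      by (simp add: sum_nonneg del: of_real_divide)
    finally show "(\<Sum>i<N. \<Sum>j<N. cnj (c i) * c j * \<phi> n (inv (g i) \<otimes> g j)) \<in> \<real>\<^sub>\<ge>\<^sub>0" .
  qed
  moreover have "c0_on (carrier G) (\<phi> n)" for n
    unfolding c0_on_def
  proof (intro allI impI)
    fix \<epsilon> :: real assume "\<epsilon> > 0"
    have cover: "g \<in> (\<lambda>(x, y). y \<otimes> inv x) ` (F n \<times> F n)" if g: "g \<in> carrier G" "cmod (\<phi> n g) \<ge> \<epsilon>" for g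
    proof -
      have "{x \<in> F n. g \<otimes> x \<in> F n} \<noteq> {}"
      proof
        assume "{x \<in> F n. g \<otimes> x \<in> F n} = {}"
        then have "\<phi> n g = 0" unfolding \<phi>_def by (simp only: card.empty of_nat_0 div_0 of_real_0)
        then show False using g(2) \<open>\<epsilon> > 0\<close> by simp
      qed
      then obtain x where x: "x \<in> F n" "g \<otimes> x \<in> F n" by blast
      then have "x \<in> carrier G" using F(1) by blast
      then have "g = g \<otimes> x \<otimes> inv x"
        using g by (simp add: m_assoc)
      with x show ?thesis by (intro image_eqI[of _ _ "(x, g \<otimes> x)"]) auto
    qed
    have "finite ((\<lambda>(x, y). y \<otimes> inv x) ` (F n \<times> F n))"
      using F(2) by blast
    then show "finite {g \<in> carrier G. cmod (\<phi> n g) \<ge> \<epsilon>}"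
      by (rule rev_finite_subset) (use cover in blast)
  qed
  moreover have "(\<lambda>n. \<phi> n g) \<longlonglongrightarrow> 1" if "g \<in> carrier G" for g
    using tendsto_of_real[OF lim[OF that], where ?'a = complex] by (simp add: \<phi>_def)
  ultimately show ?thesis
    using assms(1,2) unfolding haagerup_property_def by blast
qed

section \<open>Boxes in the upper triangular affine group\<close>

text \<open>The coordinates are bounded according to their degree in the lower central series; translation by a
  fixed element then changes a coordinate of degree \<open>k\<close> by \<open>O(n ^ (k - 1))\<close> on the box with radii
  \<open>n\<close>, \<open>n\<^sup>2\<close>, \<open>n\<^sup>3\<close>.\<close>

definition affine_box :: "nat \<Rightarrow> nat \<Rightarrow> nat \<Rightarrow> ((int ^ 3) \<times> (int ^ 3 ^ 3)) set"
  where "affine_box \<alpha> \<beta> \<gamma> = {(v, A). A \<in> upper_triangular_SL3Z \<and>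
    \<bar>v $ 3\<bar> \<le> int \<alpha> \<and> \<bar>A $ 1 $ 2\<bar> \<le> int \<alpha> \<and> \<bar>A $ 2 $ 3\<bar> \<le> int \<alpha> \<and>
    \<bar>v $ 2\<bar> \<le> int \<beta> \<and> \<bar>A $ 1 $ 3\<bar> \<le> int \<beta> \<and> \<bar>v $ 1\<bar> \<le> int \<gamma>}"

lemma mem_upper_triangular_SL3Z:
  "A \<in> upper_triangular_SL3Z \<longleftrightarrow>
    A $ 1 $ 1 * A $ 2 $ 2 * A $ 3 $ 3 = 1 \<and> A $ 2 $ 1 = 0 \<and> A $ 3 $ 1 = 0 \<and> A $ 3 $ 2 = 0"
  by (auto simp: upper_triangular_SL3Z_def SL3Z_def det_3)

lemma int_prod3_eq_1:
  fixes r s t :: int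
  assumes "r * s * t = 1"
  shows "r \<in> {-1, 1}" "s \<in> {-1, 1}" "t \<in> {-1, 1}"
proof -
  have "r * (s * t) = 1" "s * (r * t) = 1" "t * (r * s) = 1"
    using assms by (simp_all add: ac_simps)
  then show "r \<in> {-1, 1}" "s \<in> {-1, 1}" "t \<in> {-1, 1}"
    by (metis insertI1 insertI2 zmult_eq_1_iff)+
qed

lemma upper_triangular_diagonal:
  assumes "A \<in> upper_triangular_SL3Z"
  shows "A $ 1 $ 1 \<in> {-1, 1}" "A $ 2 $ 2 \<in> {-1, 1}" "A $ 3 $ 3 \<in> {-1, 1}"
  using assms int_prod3_eq_1[of "A $ 1 $ 1" "A $ 2 $ 2" "A $ 3 $ 3"]
  unfolding mem_upper_triangular_SL3Z by blast+

text \<open>A box is a product of intervals and the finite set of sign patterns on the diagonal. The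
  number d of these patterns cancels in the Folner quotient; only its positivity matters.\<close>

lemma card_affine_box:
  obtains d where "d > 0" "\<And>\<alpha> \<beta> \<gamma>. finite (affine_box \<alpha> \<beta> \<gamma>)"
    "\<And>\<alpha> \<beta> \<gamma>. card (affine_box \<alpha> \<beta> \<gamma>) = (2 * \<alpha> + 1) ^ 3 * (2 * \<beta> + 1)\<^sup>2 * (2 * \<gamma> + 1) * d"
proof -
  define D :: "(int \<times> int \<times> int) set" where "D = {(r, s, t). r * s * t = 1}"
  define Q where "Q \<alpha> \<beta> \<gamma> = {- int \<alpha>..int \<alpha>} \<times> {- int \<alpha>..int \<alpha>} \<times> {- int \<alpha>..int \<alpha>} \<times>
    {- int \<beta>..int \<beta>} \<times> {- int \<beta>..int \<beta>} \<times> {- int \<gamma>..int \<gamma>} \<times> D" for \<alpha> \<beta> \<gamma>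
  have "D \<subseteq> {-1, 1} \<times> {-1, 1} \<times> {-1, 1}"
    using int_prod3_eq_1 unfolding D_def by blast
  then have D: "finite D" by (rule finite_subset) auto
  have "(1, 1, 1) \<in> D" by (simp add: D_def)
  then have "card D > 0" using D by (auto simp: card_gt_0_iff)
  have Q: "finite (Q \<alpha> \<beta> \<gamma>)"
    "card (Q \<alpha> \<beta> \<gamma>) = (2 * \<alpha> + 1) ^ 3 * (2 * \<beta> + 1)\<^sup>2 * (2 * \<gamma> + 1) * card D" for \<alpha> \<beta> \<gamma>
  proof -
    have "card {- int n..int n} = 2 * n + 1" for n by simp
    then show "card (Q \<alpha> \<beta> \<gamma>) = (2 * \<alpha> + 1) ^ 3 * (2 * \<beta> + 1)\<^sup>2 * (2 * \<gamma> + 1) * card D"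
      by (simp only: Q_def card_cartesian_product power3_eq_cube power2_eq_square mult.assoc)
    show "finite (Q \<alpha> \<beta> \<gamma>)" using D by (simp add: Q_def)
  qed
  define f :: "(int ^ 3) \<times> (int ^ 3 ^ 3) \<Rightarrow> _"
    where "f = (\<lambda>(v, A). (v $ 3, A $ 1 $ 2, A $ 2 $ 3, v $ 2, A $ 1 $ 3, v $ 1, A $ 1 $ 1, A $ 2 $ 2, A $ 3 $ 3))"
  define g :: "_ \<Rightarrow> (int ^ 3) \<times> (int ^ 3 ^ 3)"
    where "g = (\<lambda>(z, a, b, y, c, x, r, s, t).
      (vector [x, y, z], vector [vector [r, a, c], vector [0, s, b], vector [0, 0, t]]))"
  have bij: "bij_betw f (affine_box \<alpha> \<beta> \<gamma>) (Q \<alpha> \<beta> \<gamma>)" for \<alpha> \<beta> \<gamma>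
  proof (rule bij_betwI[where g = g])
    show "f \<in> affine_box \<alpha> \<beta> \<gamma> \<rightarrow> Q \<alpha> \<beta> \<gamma>"
      by (simp add: Pi_iff affine_box_def f_def Q_def D_def mem_upper_triangular_SL3Z abs_le_iff)
    show "g \<in> Q \<alpha> \<beta> \<gamma> \<rightarrow> affine_box \<alpha> \<beta> \<gamma>"
      by (simp add: Pi_iff affine_box_def g_def Q_def D_def mem_upper_triangular_SL3Z abs_le_iff)
    show "g (f p) = p" if "p \<in> affine_box \<alpha> \<beta> \<gamma>" for p
      using that by (cases p)
        (simp add: affine_box_def f_def g_def mem_upper_triangular_SL3Z vec_eq_iff forall_3)
    show "f (g q) = q" for q by (simp add: f_def g_def split: prod.split)
  qed
  show thesis
  proof
    show "card D > 0" by fact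
    show "finite (affine_box \<alpha> \<beta> \<gamma>)" for \<alpha> \<beta> \<gamma>
      using bij_betw_finite[OF bij] Q by blast
    show "card (affine_box \<alpha> \<beta> \<gamma>) = (2 * \<alpha> + 1) ^ 3 * (2 * \<beta> + 1)\<^sup>2 * (2 * \<gamma> + 1) * card D" for \<alpha> \<beta> \<gamma>
      using bij_betw_same_card[OF bij] Q by simp
  qed
qed

text \<open>The threshold comes from \<open>n\<^sup>2 + n + 1 \<le> 3 * n\<^sup>2\<close>. It
  guarantees that the subtractions of naturals in the radii of the shrunken boxes are not cut off at
  0.\<close>

lemma radius_bounds:
  fixes C n :: nat
  assumes n: "n \<ge> 3 * C + 1"
  shows "C * (n + 1) \<le> n\<^sup>2" "C * (n\<^sup>2 + n + 1) \<le> n ^ 3"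
proof -
  have "C * (n + 1) \<le> 3 * C * n" using n by (cases n) auto
  also have "\<dots> \<le> n * n" using n by (intro mult_right_mono) auto
  finally show "C * (n + 1) \<le> n\<^sup>2" by (simp add: power2_eq_square)
  have "n \<le> n\<^sup>2" "1 \<le> n\<^sup>2" using n by (auto simp: power2_eq_square)
  then have "n\<^sup>2 + n + 1 \<le> 3 * n\<^sup>2" by linarith
  then have "C * (n\<^sup>2 + n + 1) \<le> C * (3 * n\<^sup>2)" by (rule mult_left_mono) simp
  also have "\<dots> \<le> n * n\<^sup>2" using mult_right_mono[of "3 * C" n "n\<^sup>2"] n by simp
  finally show "C * (n\<^sup>2 + n + 1) \<le> n ^ 3" by (simp add: power2_eq_square power3_eq_cube)
qed

text \<open>The points that stay in the box are not counted; an inner box with known cardinality is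
  found among them. Diagonal entries are signs and preserve absolute values, so a coordinate moves
  out by at most the off-diagonal terms. With C bounding the entries of w and those of B above the
  diagonal, these are at most \<open>C\<close>, \<open>C * (n + 1)\<close> and
  \<open>C * (n\<^sup>2 + n + 1)\<close> in degrees 1, 2 and 3.\<close>

lemma affine_box_translate:
  fixes w :: "int ^ 3" and B :: "int ^ 3 ^ 3"
  assumes B: "B \<in> upper_triangular_SL3Z"
  obtains C where "\<And>n. n \<ge> 3 * C + 1 \<Longrightarrow>
    affine_box (n - C) (n\<^sup>2 - C * (n + 1)) (n ^ 3 - C * (n\<^sup>2 + n + 1))
      \<subseteq> {p \<in> affine_box n (n\<^sup>2) (n ^ 3). (w + B *v fst p, B ** snd p) \<in> affine_box n (n\<^sup>2) (n ^ 3)}"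
proof
  let ?S = "{\<bar>w $ 1\<bar>, \<bar>w $ 2\<bar>, \<bar>w $ 3\<bar>, \<bar>B $ 1 $ 2\<bar>, \<bar>B $ 1 $ 3\<bar>, \<bar>B $ 2 $ 3\<bar>}"
  define C where "C = nat (Max ?S)"
  have "x \<le> int C" if "x \<in> ?S" for x
  proof -
    have "x \<le> Max ?S" using that by (intro Max_ge) simp_all
    then show ?thesis unfolding C_def by linarith
  qed
  then have C: "\<bar>w $ 1\<bar> \<le> int C" "\<bar>w $ 2\<bar> \<le> int C" "\<bar>w $ 3\<bar> \<le> int C"
    "\<bar>B $ 1 $ 2\<bar> \<le> int C" "\<bar>B $ 1 $ 3\<bar> \<le> int C" "\<bar>B $ 2 $ 3\<bar> \<le> int C"
    by blast+
  have sign: "\<bar>s * x + y\<bar> \<le> r" if "s \<in> {-1, 1}" "\<bar>x\<bar> \<le> r - q" "\<bar>y\<bar> \<le> q" for s x y q r :: int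
    using that by auto
  have bound: "\<bar>x * y\<bar> \<le> int C * m" if "\<bar>x\<bar> \<le> int C" "\<bar>y\<bar> \<le> m" for x y m :: int
    using that unfolding abs_mult by (intro mult_mono) auto
  have tri: "\<bar>x + y\<bar> \<le> p + q" if "\<bar>x\<bar> \<le> p" "\<bar>y\<bar> \<le> q" for x y p q :: int
    using that by linarith
  fix n :: nat assume n: "n \<ge> 3 * C + 1"
  have n2: "C * (n + 1) \<le> n\<^sup>2" and n3: "C * (n\<^sup>2 + n + 1) \<le> n ^ 3"
    using radius_bounds[OF n] by auto
  have radii: "int (n - C) = int n - int C" "int (n\<^sup>2 - C * (n + 1)) = (int n)\<^sup>2 - int C * (int n + 1)"
    "int (n ^ 3 - C * (n\<^sup>2 + n + 1)) = int n ^ 3 - int C * ((int n)\<^sup>2 + int n + 1)"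
    using n n2 n3 by (auto simp: of_nat_diff algebra_simps)
  show "affine_box (n - C) (n\<^sup>2 - C * (n + 1)) (n ^ 3 - C * (n\<^sup>2 + n + 1))
      \<subseteq> {p \<in> affine_box n (n\<^sup>2) (n ^ 3). (w + B *v fst p, B ** snd p) \<in> affine_box n (n\<^sup>2) (n ^ 3)}"
  proof
    fix p assume *: "p \<in> affine_box (n - C) (n\<^sup>2 - C * (n + 1)) (n ^ 3 - C * (n\<^sup>2 + n + 1))"
    obtain v A where p: "p = (v, A)" by (cases p)
    have A: "A \<in> upper_triangular_SL3Z"
      and bd: "\<bar>v $ 3\<bar> \<le> int n - C" "\<bar>A $ 1 $ 2\<bar> \<le> int n - C" "\<bar>A $ 2 $ 3\<bar> \<le> int n - C"
        "\<bar>v $ 2\<bar> \<le> (int n)\<^sup>2 - C * (int n + 1)" "\<bar>A $ 1 $ 3\<bar> \<le> (int n)\<^sup>2 - C * (int n + 1)"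
        "\<bar>v $ 1\<bar> \<le> int n ^ 3 - C * ((int n)\<^sup>2 + int n + 1)"
      using *[unfolded affine_box_def radii p mem_Collect_eq case_prod_conv] by blast+
    have nn: "0 \<le> int C * (int n + 1)" "0 \<le> int C * ((int n)\<^sup>2 + int n + 1)" by simp_all
    have dA: "A $ 2 $ 2 \<in> {-1, 1}" "A $ 3 $ 3 \<in> {-1, 1}" and dB: "B $ 1 $ 1 \<in> {-1, 1}" "B $ 2 $ 2 \<in> {-1, 1}" "B $ 3 $ 3 \<in> {-1, 1}"
      using upper_triangular_diagonal A B by auto
    have small: "\<bar>v $ 3\<bar> \<le> int n" "\<bar>A $ 2 $ 3\<bar> \<le> int n" "\<bar>v $ 2\<bar> \<le> (int n)\<^sup>2"
      "\<bar>A $ 3 $ 3\<bar> \<le> 1" "\<bar>A $ 2 $ 2\<bar> \<le> 1"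
      using order_trans[OF bd(1)] order_trans[OF bd(3)] order_trans[OF bd(4)] nn dA by auto
    have up: "B ** A \<in> upper_triangular_SL3Z"
      using subgroup.m_closed[OF subgroup_upper_triangular_SL3Z B A] by (simp add: SL3Z_def)
    have zero: "B $ 2 $ 1 = 0" "B $ 3 $ 1 = 0" "B $ 3 $ 2 = 0" "A $ 2 $ 1 = 0" "A $ 3 $ 1 = 0" "A $ 3 $ 2 = 0"
      using A B by (auto simp: mem_upper_triangular_SL3Z)
    have v3: "\<bar>(w + B *v v) $ 3\<bar> \<le> int n"
    proof -
      have "(w + B *v v) $ 3 = B $ 3 $ 3 * v $ 3 + w $ 3"
        by (simp add: matrix_vector_mult_def sum_3 zero)
      then show ?thesis using sign[OF dB(3) bd(1) C(3)] by simp
    qed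
    have a12: "\<bar>(B ** A) $ 1 $ 2\<bar> \<le> int n"
    proof -
      have "(B ** A) $ 1 $ 2 = B $ 1 $ 1 * A $ 1 $ 2 + B $ 1 $ 2 * A $ 2 $ 2"
        by (simp add: matrix_matrix_mult_def sum_3 zero)
      then show ?thesis using sign[OF dB(1) bd(2) bound[OF C(4) small(5), simplified]] by simp
    qed
    have a23: "\<bar>(B ** A) $ 2 $ 3\<bar> \<le> int n"
    proof -
      have "(B ** A) $ 2 $ 3 = B $ 2 $ 2 * A $ 2 $ 3 + B $ 2 $ 3 * A $ 3 $ 3"
        by (simp add: matrix_matrix_mult_def sum_3 zero)
      then show ?thesis using sign[OF dB(2) bd(3) bound[OF C(6) small(4), simplified]] by simp
    qed
    have v2: "\<bar>(w + B *v v) $ 2\<bar> \<le> (int n)\<^sup>2"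
    proof -
      have "(w + B *v v) $ 2 = B $ 2 $ 2 * v $ 2 + (B $ 2 $ 3 * v $ 3 + w $ 2)"
        by (simp add: matrix_vector_mult_def sum_3 zero)
      moreover have "\<bar>B $ 2 $ 3 * v $ 3 + w $ 2\<bar> \<le> int C * (int n + 1)"
        using tri[OF bound[OF C(6) small(1)] C(2)] by (simp add: distrib_left)
      ultimately show ?thesis by (simp only: sign[OF dB(2) bd(4)])
    qed
    have a13: "\<bar>(B ** A) $ 1 $ 3\<bar> \<le> (int n)\<^sup>2"
    proof -
      have "(B ** A) $ 1 $ 3 = B $ 1 $ 1 * A $ 1 $ 3 + (B $ 1 $ 2 * A $ 2 $ 3 + B $ 1 $ 3 * A $ 3 $ 3)"
        by (simp add: matrix_matrix_mult_def sum_3 zero)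
      moreover have "\<bar>B $ 1 $ 2 * A $ 2 $ 3 + B $ 1 $ 3 * A $ 3 $ 3\<bar> \<le> int C * (int n + 1)"
        using tri[OF bound[OF C(4) small(2)] bound[OF C(5) small(4)]] by (simp add: distrib_left)
      ultimately show ?thesis by (simp only: sign[OF dB(1) bd(5)])
    qed
    have v1: "\<bar>(w + B *v v) $ 1\<bar> \<le> int n ^ 3"
    proof -
      have "(w + B *v v) $ 1 = B $ 1 $ 1 * v $ 1 + (B $ 1 $ 2 * v $ 2 + B $ 1 $ 3 * v $ 3 + w $ 1)"
        by (simp add: matrix_vector_mult_def sum_3)
      moreover have "\<bar>B $ 1 $ 2 * v $ 2 + B $ 1 $ 3 * v $ 3 + w $ 1\<bar> \<le> int C * ((int n)\<^sup>2 + int n + 1)"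
        using tri[OF tri[OF bound[OF C(4) small(3)] bound[OF C(5) small(1)]] C(1)]
        by (simp add: distrib_left)
      ultimately show ?thesis by (simp only: sign[OF dB(1) bd(6)])
    qed
    have "(v, A) \<in> affine_box n (n\<^sup>2) (n ^ 3)"
      unfolding affine_box_def using A bd(1-3) order_trans[OF bd(4)] order_trans[OF bd(5)] order_trans[OF bd(6)] nn
      by simp
    then show "p \<in> {p \<in> affine_box n (n\<^sup>2) (n ^ 3). (w + B *v fst p, B ** snd p) \<in> affine_box n (n\<^sup>2) (n ^ 3)}"
      using v1 v2 v3 a12 a13 a23 up by (simp add: p affine_box_def)
  qed
qed

lemma affine_box_Folner:
  fixes w :: "int ^ 3" and B :: "int ^ 3 ^ 3"
  assumes B: "B \<in> upper_triangular_SL3Z"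
  defines "F \<equiv> \<lambda>n. affine_box n (n\<^sup>2) (n ^ 3)"
  shows "(\<lambda>n. real (card {p \<in> F n. (w + B *v fst p, B ** snd p) \<in> F n}) / real (card (F n))) \<longlonglongrightarrow> 1"
proof -
  obtain d where d: "d > 0" and fin: "\<And>\<alpha> \<beta> \<gamma>. finite (affine_box \<alpha> \<beta> \<gamma>)"
    and card: "\<And>\<alpha> \<beta> \<gamma>. card (affine_box \<alpha> \<beta> \<gamma>) = (2 * \<alpha> + 1) ^ 3 * (2 * \<beta> + 1)\<^sup>2 * (2 * \<gamma> + 1) * d"
    using card_affine_box by blast
  obtain C where C: "\<And>n. n \<ge> 3 * C + 1 \<Longrightarrow>
    affine_box (n - C) (n\<^sup>2 - C * (n + 1)) (n ^ 3 - C * (n\<^sup>2 + n + 1))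
      \<subseteq> {p \<in> F n. (w + B *v fst p, B ** snd p) \<in> F n}"
    using affine_box_translate[OF B] unfolding F_def by blast
  \<comment> \<open>The ratio of the inner to the outer box after cancelling d, with real
    subtractions so that its limit can be computed directly.\<close>
  define q where "q n = ((2 * (real n - real C) + 1) / (2 * real n + 1)) ^ 3 *
    ((2 * ((real n)\<^sup>2 - real C * (real n + 1)) + 1) / (2 * (real n)\<^sup>2 + 1))\<^sup>2 *
    ((2 * (real n ^ 3 - real C * ((real n)\<^sup>2 + real n + 1)) + 1) / (2 * real n ^ 3 + 1))" for n
  have qlim: "q \<longlonglongrightarrow> 1" unfolding q_def by real_asymp
  have card_real: "real (card (affine_box \<alpha> \<beta> \<gamma>))
      = (2 * real \<alpha> + 1) ^ 3 * (2 * real \<beta> + 1)\<^sup>2 * (2 * real \<gamma> + 1) * real d" for \<alpha> \<beta> \<gamma>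
    by (simp only: card of_nat_mult of_nat_power of_nat_add of_nat_numeral of_nat_1)
  have F0: "card (F n) > 0" for n using d by (simp add: F_def card)
  have lower: "q n \<le> real (card {p \<in> F n. (w + B *v fst p, B ** snd p) \<in> F n}) / real (card (F n))"
    if n: "n \<ge> 3 * C + 1" for n
  proof -
    have n2: "C * (n + 1) \<le> n\<^sup>2" and n3: "C * (n\<^sup>2 + n + 1) \<le> n ^ 3"
      using radius_bounds[OF n] by auto
    have radii: "real (n - C) = real n - real C" "real (n\<^sup>2 - C * (n + 1)) = (real n)\<^sup>2 - real C * (real n + 1)"
      "real (n ^ 3 - C * (n\<^sup>2 + n + 1)) = real n ^ 3 - real C * ((real n)\<^sup>2 + real n + 1)"
      using n n2 n3 by (auto simp: of_nat_diff algebra_simps)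
    have "q n = real (card (affine_box (n - C) (n\<^sup>2 - C * (n + 1)) (n ^ 3 - C * (n\<^sup>2 + n + 1)))) / real (card (F n))"
      unfolding F_def card_real radii q_def power_divide times_divide_times_eq
      using d by (subst mult_divide_mult_cancel_right) simp_all
    also have "\<dots> \<le> real (card {p \<in> F n. (w + B *v fst p, B ** snd p) \<in> F n}) / real (card (F n))"
      using C[OF n] F0[of n] fin by (intro divide_right_mono of_nat_mono card_mono) (auto simp: F_def)
    finally show ?thesis .
  qed
  have upper: "real (card {p \<in> F n. (w + B *v fst p, B ** snd p) \<in> F n}) / real (card (F n)) \<le> 1" for n
    using F0[of n] fin by (simp add: F_def card_mono divide_le_eq_1)
  show ?thesis
    by (rule tendsto_sandwich[OF eventually_sequentiallyI[OF lower]
          always_eventually[OF allI[OF upper]] qlim tendsto_const])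
qed

section \<open>The affine group over \<open>SL3Z\<close> and its upper triangular subgroup\<close>

abbreviation affine_SL3Z :: "((int ^ 3) \<times> (int ^ 3 ^ 3)) monoid"
  where "affine_SL3Z \<equiv> semidirect_product Z3 SL3Z matrix_vector_mult"

abbreviation affine_upper_triangular :: "((int ^ 3) \<times> (int ^ 3 ^ 3)) set"
  where "affine_upper_triangular \<equiv>
    carrier (semidirect_product Z3 (SL3Z\<lparr>carrier := upper_triangular_SL3Z\<rparr>) matrix_vector_mult)"

lemma SL3Z_simps:
  "A \<otimes>\<^bsub>SL3Z\<^esub> B = A ** B" "\<one>\<^bsub>SL3Z\<^esub> = mat 1"
  by (simp_all add: SL3Z_def)

lemma affine_SL3Z_simps [simp]:
  "(v, A) \<otimes>\<^bsub>affine_SL3Z\<^esub> (w, B) = (v + A *v w, A ** B)"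
  "\<one>\<^bsub>affine_SL3Z\<^esub> = (0, mat 1)"
  "(v, A) \<in> carrier affine_SL3Z \<longleftrightarrow> det A = 1"
  "(v, A) \<in> affine_upper_triangular \<longleftrightarrow> A \<in> upper_triangular_SL3Z"
  by (auto simp: semidirect_product_def Z3_def SL3Z_def)

lemma inv_affine_SL3Z:
  assumes "det A = 1" "det B = 1" "B ** A = mat 1"
  shows "inv\<^bsub>affine_SL3Z\<^esub> (v, A) = (- (B *v v), B)"
  by (rule group.inv_equality[OF group_Z3_SL3Z]) (use assms in simp_all)

lemma subgroup_affine_upper_triangular: "subgroup affine_upper_triangular affine_SL3Z"
proof (rule group.subgroupI[OF group_Z3_SL3Z])
  show "affine_upper_triangular \<subseteq> carrier affine_SL3Z"
    by (auto simp: semidirect_product_def upper_triangular_SL3Z_def)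
  have "(0, mat 1) \<in> affine_upper_triangular"
    using subgroup.one_closed[OF subgroup_upper_triangular_SL3Z] by (simp add: SL3Z_simps)
  then show "affine_upper_triangular \<noteq> {}" by blast
  fix p assume p: "p \<in> affine_upper_triangular"
  obtain v A where vA: "p = (v, A)" by (cases p)
  have A: "A \<in> upper_triangular_SL3Z" using p by (simp add: vA)
  then have "det A = 1" by (simp add: upper_triangular_SL3Z_def SL3Z_def)
  then obtain B where B: "det B = 1" "B ** A = mat 1" "B \<in> upper_triangular_SL3Z"
    using ex_inv_SL3Z A by blast
  show "inv\<^bsub>affine_SL3Z\<^esub> p \<in> affine_upper_triangular"
    using inv_affine_SL3Z[OF \<open>det A = 1\<close> B(1,2)] B(3) by (simp add: vA)
  fix q assume "q \<in> affine_upper_triangular"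
  then show "p \<otimes>\<^bsub>affine_SL3Z\<^esub> q \<in> affine_upper_triangular"
    using subgroup.m_closed[OF subgroup_upper_triangular_SL3Z A]
    by (cases q) (simp add: vA SL3Z_simps)
qed

lemma haagerup_subgroup_affine_upper_triangular:
  "haagerup_subgroup affine_upper_triangular affine_SL3Z"
  unfolding haagerup_subgroup_def
proof
  show "subgroup affine_upper_triangular affine_SL3Z"
    by (rule subgroup_affine_upper_triangular)
  then have "group (affine_SL3Z\<lparr>carrier := affine_upper_triangular\<rparr>)"
    using group_Z3_SL3Z subgroup.subgroup_is_group by blast
  then show "haagerup_property (affine_SL3Z\<lparr>carrier := affine_upper_triangular\<rparr>)"
  proof (rule haagerup_property_Folner[where F = "\<lambda>n. affine_box n (n\<^sup>2) (n ^ 3)"])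
    have "countable (UNIV :: ((int ^ 3) \<times> (int ^ 3 ^ 3)) set)"
      by (rule countableI_type)
    then show "countable (carrier (affine_SL3Z\<lparr>carrier := affine_upper_triangular\<rparr>))"
      by (rule countable_subset[OF subset_UNIV])
    fix n
    show "affine_box n (n\<^sup>2) (n ^ 3) \<subseteq> carrier (affine_SL3Z\<lparr>carrier := affine_upper_triangular\<rparr>)"
      by (rule subsetI) (simp add: affine_box_def split_paired_all)
    show "finite (affine_box n (n\<^sup>2) (n ^ 3))"
      by (rule card_affine_box) 
  next
    fix g assume "g \<in> carrier (affine_SL3Z\<lparr>carrier := affine_upper_triangular\<rparr>)"
    moreover obtain w B where g: "g = (w, B)" by (cases g)
    ultimately have B: "B \<in> upper_triangular_SL3Z" by simp
    have mult: "g \<otimes>\<^bsub>affine_SL3Z\<lparr>carrier := affine_upper_triangular\<rparr>\<^esub> p = (w + B *v fst p, B ** snd p)" for p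
      by (cases p) (simp add: g)
    show "(\<lambda>n. real (card {p \<in> affine_box n (n\<^sup>2) (n ^ 3).
        g \<otimes>\<^bsub>affine_SL3Z\<lparr>carrier := affine_upper_triangular\<rparr>\<^esub> p \<in> affine_box n (n\<^sup>2) (n ^ 3)})
          / real (card (affine_box n (n\<^sup>2) (n ^ 3)))) \<longlonglongrightarrow> 1"
      unfolding mult by (rule affine_box_Folner[OF B])
  qed
qed

section \<open>Finite approximations of the spectral measure\<close>

text \<open>Points of the torus are represented by arbitrary real angles, without a quotient by
  multiples of 2 pi; the integrality of k makes the cosines periodic.\<close>

definition pairing :: "int ^ 'n \<Rightarrow> ('n \<Rightarrow> real) \<Rightarrow> real"
  where "pairing k \<theta> = (\<Sum>i\<in>UNIV. of_int (k $ i) * \<theta> i)"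

lemma pairing_add: "pairing (k + l) \<theta> = pairing k \<theta> + pairing l \<theta>"
  by (simp add: pairing_def sum.distrib algebra_simps)

lemma pairing_diff: "pairing (k - l) \<theta> = pairing k \<theta> - pairing l \<theta>"
  by (simp add: pairing_def sum_subtractf algebra_simps)

lemma pairing_0 [simp]: "pairing 0 \<theta> = 0"
  by (simp add: pairing_def)

definition lattice_box :: "int \<Rightarrow> int \<Rightarrow> (int ^ 'n) set"
  where "lattice_box a b = {k. \<forall>i. a \<le> k $ i \<and> k $ i < b}"

lemma bij_betw_lattice_box:
  "bij_betw vec_nth (lattice_box a b :: (int ^ 'n) set) (PiE UNIV (\<lambda>_. {a..<b}))"
  by (rule bij_betwI[where g = vec_lambda]) (auto simp: lattice_box_def)

lemma finite_lattice_box [simp]: "finite (lattice_box a b)"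
  using bij_betw_finite[OF bij_betw_lattice_box] by (simp add: finite_PiE)

lemma sum_prod_lattice_box:
  fixes f :: "'n::finite \<Rightarrow> int \<Rightarrow> 'a::comm_semiring_1"
  shows "(\<Sum>k\<in>lattice_box a b. \<Prod>i\<in>UNIV. f i (k $ i)) = (\<Prod>i\<in>UNIV. \<Sum>j\<in>{a..<b}. f i j)"
  by (subst sum.reindex_bij_betw[OF bij_betw_lattice_box]) (simp add: prod_sum_PiE)

lemma card_lattice_box: "card (lattice_box a b :: (int ^ 'n) set) = nat (b - a) ^ CARD('n)"
  using sum_prod_lattice_box[of "\<lambda>(_ :: 'n) _. 1 :: nat" a b] by simp

lemma sum_cis_roots_of_unity:
  assumes "M > 0"
  shows "(\<Sum>j\<in>{0..<int M}. cis (of_int l * (2 * pi * of_int j / real M)))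
    = (if int M dvd l then of_nat M else 0)"
proof -
  define z where "z = cis (2 * pi * of_int l / real M)"
  have "(\<Sum>j\<in>{0..<int M}. cis (of_int l * (2 * pi * of_int j / real M))) = (\<Sum>j<M. z ^ j)"
  proof -
    have "cis (of_int l * (2 * pi * of_int (int j) / real M)) = z ^ j" for j
      unfolding z_def Complex.DeMoivre by (rule arg_cong[where f = cis]) simp
    then show ?thesis
      by (subst sum.reindex_bij_betw[of int "{..<M}", symmetric])
         (auto simp: bij_betw_def image_int_atLeastLessThan lessThan_atLeast0)
  qed
  moreover have "z ^ M = 1"
  proof -
    have "z ^ M = cis (2 * pi * of_int l)" using assms by (simp add: z_def Complex.DeMoivre)
    then show ?thesis by simp
  qed
  moreover have "z = 1 \<longleftrightarrow> int M dvd l"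
  proof
    assume "z = 1"
    then have "cos (2 * pi * of_int l / real M) = 1" by (simp add: z_def complex_eq_iff)
    then obtain n :: int where "2 * pi * of_int l / real M = n * 2 * pi"
      by (auto simp: cos_one_2pi_int)
    then have "real_of_int l = real_of_int (n * int M)" using assms by (simp add: field_simps)
    then have "l = n * int M" by (simp only: of_int_eq_iff)
    then show "int M dvd l" by simp
  next
    assume "int M dvd l"
    then obtain k where "l = int M * k" by (elim dvdE)
    then have "2 * pi * of_int l / real M = 2 * pi * of_int k" using assms by simp
    then have "z = cis (2 * pi * of_int k)" by (simp only: z_def)
    then show "z = 1" by simp
  qed
  ultimately show ?thesis
    by (cases "z = 1") (auto simp: sum_gp_strict)
qed

definition grid_point :: "nat \<Rightarrow> int ^ 'n \<Rightarrow> 'n \<Rightarrow> real"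
  where "grid_point M t i = 2 * pi * of_int (t $ i) / real M"

text \<open>Orthogonality of the characters of \<open>(Z/M)^n\<close>: the complex exponentials
  factorize over the coordinates, and the real part is taken at the end.\<close>

lemma sum_cos_grid:
  fixes l :: "int ^ 'n"
  assumes "M > 0"
  shows "(\<Sum>t\<in>lattice_box 0 (int M). cos (pairing l (grid_point M t)))
    = (if \<forall>i. int M dvd l $ i then real M ^ CARD('n) else 0)"
proof -
  have "cis (pairing l \<theta>) = (\<Prod>i\<in>UNIV. cis (of_int (l $ i) * \<theta> i))" for \<theta>
    unfolding pairing_def by (simp add: cis_conv_exp exp_sum sum_distrib_left)
  then have "(\<Sum>t\<in>lattice_box 0 (int M). cis (pairing l (grid_point M t)))
      = (\<Sum>t\<in>lattice_box 0 (int M). \<Prod>i\<in>UNIV. cis (of_int (l $ i) * (2 * pi * of_int (t $ i) / real M)))"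
    by (simp add: grid_point_def)
  also have "\<dots> = (\<Prod>i\<in>UNIV. if int M dvd l $ i then of_nat M else 0)"
    by (subst sum_prod_lattice_box[where f = "\<lambda>i j. cis (of_int (l $ i) * (2 * pi * of_int j / real M))"])
       (simp only: sum_cis_roots_of_unity[OF assms])
  also have "\<dots> = (if \<forall>i. int M dvd l $ i then of_nat M ^ CARD('n) else 0)"
    by auto
  finally have "Re (\<Sum>t\<in>lattice_box 0 (int M). cis (pairing l (grid_point M t)))
      = Re (if \<forall>i. int M dvd l $ i then of_nat M ^ CARD('n) else 0)" by simp
  then show ?thesis by (auto simp flip: of_nat_power)
qed

section \<open>Fejer means of positive definite functions\<close>

definition positive_definite_real :: "('a::ab_group_add \<Rightarrow> real) \<Rightarrow> bool"
  where "positive_definite_real \<psi> \<longleftrightarrow>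
    (\<forall>F x. finite F \<longrightarrow> 0 \<le> (\<Sum>a\<in>F. \<Sum>b\<in>F. x a * x b * \<psi> (b - a)))"

text \<open>The Fejer mean of the Fourier series of \<psi>, a density approximating its spectral
  measure. The double sum over a box, instead of a sum over differences with multiplicities,
  exhibits it as a value of the quadratic form of \<psi>.\<close>

definition fejer_weight :: "(int ^ 'n \<Rightarrow> real) \<Rightarrow> nat \<Rightarrow> ('n \<Rightarrow> real) \<Rightarrow> real"
  where "fejer_weight \<psi> N \<theta> = (\<Sum>a\<in>lattice_box 0 (int N). \<Sum>b\<in>lattice_box 0 (int N).
    \<psi> (b - a) * cos (pairing (b - a) \<theta>)) / real (N ^ CARD('n))"

lemma fejer_weight_nonneg:
  assumes "positive_definite_real \<psi>"
  shows "0 \<le> fejer_weight \<psi> N \<theta>"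
proof -
  let ?F = "lattice_box 0 (int N) :: (int ^ 'a) set"
  have "0 \<le> (\<Sum>a\<in>?F. \<Sum>b\<in>?F. x a * x b * \<psi> (b - a))" for x
    using assms by (simp add: positive_definite_real_def)
  \<comment> \<open>The cosine and sine vectors together replace the complex test vector of
    exponentials; their two forms add up to the cosine of the difference.\<close>
  from add_mono[OF this[of "\<lambda>a. cos (pairing a \<theta>)"] this[of "\<lambda>a. sin (pairing a \<theta>)"]]
  have "0 \<le> (\<Sum>a\<in>?F. \<Sum>b\<in>?F. \<psi> (b - a) * cos (pairing (b - a) \<theta>))"
    by (simp add: pairing_diff cos_diff sum.distrib algebra_simps)
  then show ?thesis by (simp add: fejer_weight_def)
qed

text \<open>The modulus \<open>5 N + 1\<close> exceeds every coordinate of the frequencies \<open>b - a \<plusminus> k\<close> that occur once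
  \<open>N\<close> is at least the coordinates of \<open>k\<close>, so that the grid does not alias them.\<close>

definition grid_mean :: "(int ^ 'n \<Rightarrow> real) \<Rightarrow> nat \<Rightarrow> (('n \<Rightarrow> real) \<Rightarrow> real) \<Rightarrow> real"
  where "grid_mean \<psi> N f = (\<Sum>t\<in>lattice_box 0 (int (5 * N + 1)).
    fejer_weight \<psi> N (grid_point (5 * N + 1) t) * f (grid_point (5 * N + 1) t))
      / real ((5 * N + 1) ^ CARD('n))"

text \<open>The product formula for cosines and orthogonality on the grid leave only the pairs with
  \<open>b = a + k\<close> or \<open>b = a - k\<close>, where evenness gives the value
  \<open>\<psi> k\<close>. The remaining factor is the Fejer multiplier, which tends to 1.\<close>

lemma grid_mean_cos:
  fixes k :: "int ^ 'n"
  assumes sym: "\<And>k. \<psi> (- k) = \<psi> k" and k: "\<And>i. \<bar>k $ i\<bar> \<le> int N" and "N > 0"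
  shows "grid_mean \<psi> N (\<lambda>\<theta>. cos (pairing k \<theta>)) = \<psi> k *
    (real (card {a \<in> lattice_box 0 (int N). a + k \<in> lattice_box 0 (int N)})
     + real (card {a \<in> lattice_box 0 (int N). a - k \<in> lattice_box 0 (int N)})) / (2 * real (N ^ CARD('n)))"
proof -
  let ?F = "lattice_box 0 (int N) :: (int ^ 'n) set"
  define M where "M = 5 * N + 1"
  have M: "int M > 4 * int N" "M > 0" by (simp_all add: M_def)
  let ?G = "lattice_box 0 (int M) :: (int ^ 'n) set"
  let ?p = "grid_point M :: int ^ 'n \<Rightarrow> _"
  have dvd: "(\<forall>i. int M dvd l $ i) \<longleftrightarrow> l = 0" if "\<And>i. \<bar>l $ i\<bar> \<le> 2 * int N" for l :: "int ^ 'n"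
  proof
    assume *: "\<forall>i. int M dvd l $ i"
    have "l $ i = 0" for i
    proof (rule ccontr)
      assume "l $ i \<noteq> 0"
      then have "\<bar>int M\<bar> \<le> \<bar>l $ i\<bar>" using * dvd_imp_le_int by blast
      then show False using that[of i] M by linarith
    qed
    then show "l = 0" by (simp add: vec_eq_iff)
  qed auto
  have inner: "(\<Sum>t\<in>?G. cos (pairing (b - a) (?p t)) * cos (pairing k (?p t)))
      = real (M ^ CARD('n)) * ((of_bool (b = a + k) + of_bool (b = a - k)) / 2)"
    if "a \<in> ?F" "b \<in> ?F" for a b
  proof -
    have small: "\<bar>(b - a - k) $ i\<bar> \<le> 2 * int N" "\<bar>(b - a + k) $ i\<bar> \<le> 2 * int N" for i
    proof -
      have "0 \<le> a $ i" "a $ i < int N" "0 \<le> b $ i" "b $ i < int N"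
        using that by (auto simp: lattice_box_def)
      then show "\<bar>(b - a - k) $ i\<bar> \<le> 2 * int N" "\<bar>(b - a + k) $ i\<bar> \<le> 2 * int N"
        using k[of i] by auto
    qed
    have "(\<Sum>t\<in>?G. cos (pairing (b - a) (?p t)) * cos (pairing k (?p t)))
        = ((\<Sum>t\<in>?G. cos (pairing (b - a - k) (?p t))) + (\<Sum>t\<in>?G. cos (pairing (b - a + k) (?p t)))) / 2"
      by (simp add: cos_times_cos pairing_diff pairing_add sum.distrib flip: sum_divide_distrib)
    also have "\<dots> = ((if b - a - k = 0 then real M ^ CARD('n) else 0)
        + (if b - a + k = 0 then real M ^ CARD('n) else 0)) / 2"
      by (simp only: sum_cos_grid[OF M(2)] dvd[OF small(1)] dvd[OF small(2)])
    also have "b - a - k = 0 \<longleftrightarrow> b = a + k" by (auto simp: algebra_simps)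
    also have "b - a + k = 0 \<longleftrightarrow> b = a - k" by (auto simp: algebra_simps)
    finally show ?thesis by (simp add: of_bool_def)
  qed
  define m where "m = real (M ^ CARD('n))"
  define n where "n = real (N ^ CARD('n))"
  have mn: "m > 0" "n > 0" using M \<open>N > 0\<close> by (simp_all add: m_def n_def)
  have clear: "(\<Sum>t\<in>?G. S t / n * f t) / m * (m * n) = (\<Sum>t\<in>?G. S t * f t)" for S f :: "int ^ 'n \<Rightarrow> real"
  proof -
    have "(\<Sum>t\<in>?G. S t / n * f t) / m * (m * n) = (\<Sum>t\<in>?G. S t / n * f t) * n"
      using mn by simp
    also have "\<dots> = (\<Sum>t\<in>?G. S t * f t)"
      unfolding sum_distrib_right using mn by (intro sum.cong) simp_all
    finally show ?thesis .
  qed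
  have "grid_mean \<psi> N (\<lambda>\<theta>. cos (pairing k \<theta>)) * (m * n)
      = (\<Sum>t\<in>?G. \<Sum>a\<in>?F. \<Sum>b\<in>?F. \<psi> (b - a) * (cos (pairing (b - a) (?p t)) * cos (pairing k (?p t))))"
    unfolding grid_mean_def fejer_weight_def M_def[symmetric] m_def[symmetric] n_def[symmetric] clear
    by (simp only: sum_distrib_right mult.assoc)
  also have "\<dots> = (\<Sum>a\<in>?F. \<Sum>b\<in>?F. \<psi> (b - a) * (\<Sum>t\<in>?G. cos (pairing (b - a) (?p t)) * cos (pairing k (?p t))))"
    unfolding sum_distrib_left by (subst sum.swap, rule sum.cong[OF refl], subst sum.swap) (rule refl)
  also have "\<dots> = (\<Sum>a\<in>?F. \<Sum>b\<in>?F. m * (\<psi> k / 2 * (of_bool (b = a + k) + of_bool (b = a - k))))"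
    by (intro sum.cong refl) (auto simp: inner of_bool_def sym m_def)
  also have "\<dots> = (\<Sum>a\<in>?F. m * (\<psi> k / 2 * (of_bool (a + k \<in> ?F) + of_bool (a - k \<in> ?F))))"
    unfolding sum_distrib_left[symmetric] sum.distrib by (simp add: of_bool_def sum.delta)
  also have "\<dots> = m * (\<psi> k / 2 * (real (card {a \<in> ?F. a + k \<in> ?F}) + real (card {a \<in> ?F. a - k \<in> ?F})))"
    unfolding sum_distrib_left[symmetric] sum.distrib by (simp add: sum_of_bool_eq Int_def)
  finally have "m * (grid_mean \<psi> N (\<lambda>\<theta>. cos (pairing k \<theta>)) * n)
      = m * (\<psi> k / 2 * (real (card {a \<in> ?F. a + k \<in> ?F}) + real (card {a \<in> ?F. a - k \<in> ?F})))"
    by (simp only: mult.left_commute[of m])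
  then show ?thesis
    unfolding n_def[symmetric] mult_cancel_left using mn by (simp add: eq_divide_eq)
qed

lemma lattice_box_Folner:
  fixes k :: "int ^ 'n"
  shows "(\<lambda>N. real (card {a \<in> lattice_box 0 (int N). a + k \<in> lattice_box 0 (int N)}) / real (N ^ CARD('n))) \<longlonglongrightarrow> 1"
proof -
  define C where "C = nat (\<Sum>i\<in>UNIV. \<bar>k $ i\<bar>)"
  have C: "\<bar>k $ i\<bar> \<le> int C" for i
    unfolding C_def using member_le_sum[of i UNIV "\<lambda>i. \<bar>k $ i\<bar>"] by simp
  have "(\<lambda>N. (real N - 2 * real C) / real N) \<longlonglongrightarrow> 1" by real_asymp
  from tendsto_power[OF this, of "CARD('n)"]
  have lim: "(\<lambda>N. ((real N - 2 * real C) / real N) ^ CARD('n)) \<longlonglongrightarrow> 1" by simp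
  have lower: "((real N - 2 * real C) / real N) ^ CARD('n)
      \<le> real (card {a \<in> lattice_box 0 (int N). a + k \<in> lattice_box 0 (int N)}) / real (N ^ CARD('n))"
    if N: "N \<ge> 2 * C" for N
  proof -
    have "lattice_box (int C) (int N - int C) \<subseteq> {a \<in> lattice_box 0 (int N). a + k \<in> lattice_box 0 (int N)}"
    proof
      fix a :: "int ^ 'n" assume a: "a \<in> lattice_box (int C) (int N - int C)"
      have "0 \<le> a $ i \<and> a $ i < int N \<and> 0 \<le> a $ i + k $ i \<and> a $ i + k $ i < int N" for i
      proof -
        have "int C \<le> a $ i" "a $ i < int N - int C" using a by (auto simp: lattice_box_def)
        with C[of i] show ?thesis by arith
      qed
      then show "a \<in> {a \<in> lattice_box 0 (int N). a + k \<in> lattice_box 0 (int N)}"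
        by (auto simp: lattice_box_def)
    qed
    then have "card (lattice_box (int C) (int N - int C) :: (int ^ 'n) set)
        \<le> card {a \<in> lattice_box 0 (int N). a + k \<in> lattice_box 0 (int N)}"
      by (intro card_mono) auto
    moreover have "nat (int N - int C - int C) = N - 2 * C" by linarith
    ultimately have "(N - 2 * C) ^ CARD('n) \<le> card {a \<in> lattice_box 0 (int N). a + k \<in> lattice_box 0 (int N)}"
      by (simp add: card_lattice_box)
    then have "real ((N - 2 * C) ^ CARD('n)) \<le> real (card {a \<in> lattice_box 0 (int N). a + k \<in> lattice_box 0 (int N)})"
      by (rule of_nat_mono)
    then show ?thesis using N by (simp add: power_divide of_nat_diff divide_right_mono)
  qed
  have upper: "real (card {a \<in> lattice_box 0 (int N). a + k \<in> lattice_box 0 (int N)}) / real (N ^ CARD('n)) \<le> 1" for N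
  proof -
    have "card {a \<in> lattice_box 0 (int N). a + k \<in> lattice_box 0 (int N)} \<le> card (lattice_box 0 (int N) :: (int ^ 'n) set)"
      by (intro card_mono) auto
    then show ?thesis by (cases "N = 0") (simp_all add: card_lattice_box divide_le_eq_1 flip: of_nat_power)
  qed
  show ?thesis
    by (rule tendsto_sandwich[OF eventually_sequentiallyI[OF lower]
          always_eventually[OF allI[OF upper]] lim tendsto_const])
qed

lemma grid_mean_cos_tendsto:
  fixes k :: "int ^ 'n"
  assumes sym: "\<And>k. \<psi> (- k) = \<psi> k"
  shows "(\<lambda>N. grid_mean \<psi> N (\<lambda>\<theta>. cos (pairing k \<theta>))) \<longlonglongrightarrow> \<psi> k"
proof -
  define r where "r k N = real (card {a \<in> lattice_box 0 (int N). a + k \<in> lattice_box 0 (int N)}) / real (N ^ CARD('n))"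
    for k :: "int ^ 'n" and N
  define C where "C = nat (\<Sum>i\<in>UNIV. \<bar>k $ i\<bar>)"
  have C: "\<bar>k $ i\<bar> \<le> int C" for i
    unfolding C_def using member_le_sum[of i UNIV "\<lambda>i. \<bar>k $ i\<bar>"] by simp
  have "(\<lambda>N. \<psi> k * (r k N + r (- k) N) / 2) \<longlonglongrightarrow> \<psi> k * (1 + 1) / 2"
    unfolding r_def by (intro tendsto_intros lattice_box_Folner) simp
  moreover have "\<psi> k * (r k N + r (- k) N) / 2 = grid_mean \<psi> N (\<lambda>\<theta>. cos (pairing k \<theta>))" if "N \<ge> C + 1" for N
  proof -
    have "\<bar>k $ i\<bar> \<le> int N" for i using C[of i] that by linarith
    then have "grid_mean \<psi> N (\<lambda>\<theta>. cos (pairing k \<theta>)) = \<psi> k *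
        (real (card {a \<in> lattice_box 0 (int N). a + k \<in> lattice_box 0 (int N)})
         + real (card {a \<in> lattice_box 0 (int N). a - k \<in> lattice_box 0 (int N)})) / (2 * real (N ^ CARD('n)))"
      using that sym by (intro grid_mean_cos) auto
    also have "\<psi> k * (x + y) / (2 * n) = \<psi> k * (x / n + y / n) / 2" for x y n :: real
      by (simp add: add_divide_distrib[symmetric])
    finally show ?thesis by (simp add: r_def)
  qed
  then have "\<forall>\<^sub>F N in sequentially.
      \<psi> k * (r k N + r (- k) N) / 2 = grid_mean \<psi> N (\<lambda>\<theta>. cos (pairing k \<theta>))"
    by (rule eventually_sequentiallyI)
  ultimately show ?thesis
    by (simp add: tendsto_cong)
qed

text \<open>The even real trigonometric polynomials, which serve as test functions on the torus.
  Being generated linearly by cosines, they let identities of linear functionals be checked on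
  cosines.\<close>

inductive cos_poly :: "(('n::finite \<Rightarrow> real) \<Rightarrow> real) \<Rightarrow> bool" where
  cos_poly_cos: "cos_poly (\<lambda>\<theta>. cos (pairing k \<theta>))"
| cos_poly_add: "cos_poly f \<Longrightarrow> cos_poly g \<Longrightarrow> cos_poly (\<lambda>\<theta>. f \<theta> + g \<theta>)"
| cos_poly_cmult: "cos_poly f \<Longrightarrow> cos_poly (\<lambda>\<theta>. c * f \<theta>)"

lemma cos_poly_const: "cos_poly (\<lambda>_. c)"
  using cos_poly_cmult[OF cos_poly_cos[of 0], of c] by simp

lemma cos_poly_diff: "cos_poly f \<Longrightarrow> cos_poly g \<Longrightarrow> cos_poly (\<lambda>\<theta>. f \<theta> - g \<theta>)"
  using cos_poly_add[of f "\<lambda>\<theta>. -1 * g \<theta>"] cos_poly_cmult[of g "-1"] by simp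

lemma cos_poly_sum: "(\<And>i. i \<in> I \<Longrightarrow> cos_poly (f i)) \<Longrightarrow> cos_poly (\<lambda>\<theta>. \<Sum>i\<in>I. f i \<theta>)"
  by (induction I rule: infinite_finite_induct) (auto intro: cos_poly_const cos_poly_add)

lemma cos_poly_mult:
  assumes "cos_poly f" "cos_poly g"
  shows "cos_poly (\<lambda>\<theta>. f \<theta> * g \<theta>)"
  using assms
proof (induction f)
  case (cos_poly_cos k)
  from \<open>cos_poly g\<close> show ?case
  proof (induction g)
    case (cos_poly_cos l)
    have "cos_poly (\<lambda>\<theta>. 1 / 2 * (cos (pairing (k - l) \<theta>) + cos (pairing (k + l) \<theta>)))"
      by (intro cos_poly.intros)
    then show ?case by (simp add: cos_times_cos pairing_add pairing_diff)
  next
    case (cos_poly_add f g)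
    from cos_poly.cos_poly_add[OF this(3,4)] show ?case by (simp add: distrib_left)
  next
    case (cos_poly_cmult f c)
    from cos_poly.cos_poly_cmult[OF this(2), of c] show ?case by (simp add: mult.left_commute)
  qed
next
  case (cos_poly_add f g)
  then show ?case
    using cos_poly.cos_poly_add by (fastforce simp: distrib_right)
next
  case (cos_poly_cmult f c)
  then show ?case
    using cos_poly.cos_poly_cmult[of "\<lambda>\<theta>. f \<theta> * g \<theta>" c] by (simp add: mult.assoc)
qed

lemma cos_poly_power: "cos_poly f \<Longrightarrow> cos_poly (\<lambda>\<theta>. f \<theta> ^ m)"
  by (induction m) (auto intro: cos_poly_const cos_poly_mult)

text \<open>\<theta> is treated as a row vector and multiplied by A from the right; this is the
  adjoint of the action of A on the lattice.\<close>

definition dual_action :: "int ^ 'n ^ 'n \<Rightarrow> ('n \<Rightarrow> real) \<Rightarrow> 'n \<Rightarrow> real"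
  where "dual_action A \<theta> = (\<lambda>j. \<Sum>i\<in>UNIV. of_int (A $ i $ j) * \<theta> i)"

lemma pairing_dual_action: "pairing k (dual_action A \<theta>) = pairing (A *v k) \<theta>"
  unfolding pairing_def dual_action_def matrix_vector_mult_def
  by (simp add: sum_distrib_left sum_distrib_right, subst sum.swap) (simp add: mult_ac)

lemma cos_poly_dual_action: "cos_poly f \<Longrightarrow> cos_poly (\<lambda>\<theta>. f (dual_action A \<theta>))"
  by (induction rule: cos_poly.induct) (auto simp: pairing_dual_action intro: cos_poly.intros)

section \<open>Integration against the spectral measure\<close>

definition even_function :: "('a::ab_group_add \<Rightarrow> real) \<Rightarrow> bool"
  where "even_function \<psi> \<longleftrightarrow> (\<forall>k. \<psi> (- k) = \<psi> k)"

text \<open>By Herglotz's theorem a positive definite function on \<open>\<int>\<^sup>n\<close> is the Fourier transform of a measure on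
  the torus; on cosine polynomials its integral is the following limit of finite sums.\<close>

definition spectral_mean :: "(int ^ 'n \<Rightarrow> real) \<Rightarrow> (('n \<Rightarrow> real) \<Rightarrow> real) \<Rightarrow> real"
  where "spectral_mean \<psi> f = lim (\<lambda>N. grid_mean \<psi> N f)"

lemma grid_mean_add: "grid_mean \<psi> N (\<lambda>\<theta>. f \<theta> + g \<theta>) = grid_mean \<psi> N f + grid_mean \<psi> N g"
  unfolding grid_mean_def by (simp only: distrib_left sum.distrib add_divide_distrib)

lemma grid_mean_cmult: "grid_mean \<psi> N (\<lambda>\<theta>. c * f \<theta>) = c * grid_mean \<psi> N f"
  unfolding grid_mean_def by (simp only: mult.left_commute[of _ c] sum_distrib_left[symmetric] times_divide_eq_right)

lemma grid_mean_mono: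
  assumes "positive_definite_real \<psi>" "\<And>\<theta>. f \<theta> \<le> g \<theta>"
  shows "grid_mean \<psi> N f \<le> grid_mean \<psi> N g"
  unfolding grid_mean_def
  by (intro divide_right_mono sum_mono mult_left_mono assms fejer_weight_nonneg) simp

lemma grid_mean_convergent:
  assumes "even_function \<psi>" "cos_poly f"
  shows "convergent (\<lambda>N. grid_mean \<psi> N f)"
  using assms(2)
proof induction
  case (cos_poly_cos k)
  have "(\<lambda>N. grid_mean \<psi> N (\<lambda>\<theta>. cos (pairing k \<theta>))) \<longlonglongrightarrow> \<psi> k"
    using assms(1) by (intro grid_mean_cos_tendsto) (simp add: even_function_def)
  then show ?case by (rule convergentI)
next
  case (cos_poly_add f g)
  then show ?case by (simp only: grid_mean_add convergent_add)
next
  case (cos_poly_cmult f c)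
  then show ?case unfolding grid_mean_cmult by (intro convergent_mult convergent_const)
qed

lemma spectral_mean_tendsto:
  "even_function \<psi> \<Longrightarrow> cos_poly f \<Longrightarrow> (\<lambda>N. grid_mean \<psi> N f) \<longlonglongrightarrow> spectral_mean \<psi> f"
  unfolding spectral_mean_def by (intro convergent_LIMSEQ_iff[THEN iffD1] grid_mean_convergent)

lemma spectral_mean_cos:
  assumes "even_function \<psi>"
  shows "spectral_mean \<psi> (\<lambda>\<theta>. cos (pairing k \<theta>)) = \<psi> k"
  unfolding spectral_mean_def
  using assms by (intro limI grid_mean_cos_tendsto) (simp add: even_function_def)

lemma spectral_mean_add:
  assumes "even_function \<psi>" "cos_poly f" "cos_poly g"
  shows "spectral_mean \<psi> (\<lambda>\<theta>. f \<theta> + g \<theta>) = spectral_mean \<psi> f + spectral_mean \<psi> g"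
  unfolding spectral_mean_def[of _ "\<lambda>\<theta>. f \<theta> + g \<theta>"] grid_mean_add
  using assms by (intro limI tendsto_add spectral_mean_tendsto)

lemma spectral_mean_cmult:
  assumes "even_function \<psi>" "cos_poly f"
  shows "spectral_mean \<psi> (\<lambda>\<theta>. c * f \<theta>) = c * spectral_mean \<psi> f"
  unfolding spectral_mean_def[of _ "\<lambda>\<theta>. c * f \<theta>"] grid_mean_cmult
  using assms by (intro limI tendsto_mult tendsto_const spectral_mean_tendsto)

lemma spectral_mean_const:
  assumes "even_function \<psi>"
  shows "spectral_mean \<psi> (\<lambda>_. c) = c * \<psi> 0"
  using spectral_mean_cmult[OF assms cos_poly_cos[of 0], of c] spectral_mean_cos[OF assms, of 0] by simp

lemma spectral_mean_diff:
  assumes "even_function \<psi>" "cos_poly f" "cos_poly g"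
  shows "spectral_mean \<psi> (\<lambda>\<theta>. f \<theta> - g \<theta>) = spectral_mean \<psi> f - spectral_mean \<psi> g"
  using spectral_mean_add[OF assms(1,2) cos_poly_cmult[OF assms(3)], of "-1"]
    spectral_mean_cmult[OF assms(1,3), of "-1"] by simp

lemma spectral_mean_sum:
  assumes "even_function \<psi>" "\<And>i. i \<in> I \<Longrightarrow> cos_poly (f i)"
  shows "spectral_mean \<psi> (\<lambda>\<theta>. \<Sum>i\<in>I. f i \<theta>) = (\<Sum>i\<in>I. spectral_mean \<psi> (f i))"
  using assms(2)
proof (induction I rule: infinite_finite_induct)
  case (insert i I)
  then show ?case
    by (simp add: spectral_mean_add[OF assms(1)] cos_poly_sum)
qed (simp_all add: spectral_mean_const[OF assms(1)])

lemma spectral_mean_mono: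
  assumes "even_function \<psi>" "positive_definite_real \<psi>" "cos_poly f" "cos_poly g" "\<And>\<theta>. f \<theta> \<le> g \<theta>"
  shows "spectral_mean \<psi> f \<le> spectral_mean \<psi> g"
  by (rule LIMSEQ_le[OF spectral_mean_tendsto[OF assms(1,3)] spectral_mean_tendsto[OF assms(1,4)]])
    (intro exI allI impI grid_mean_mono assms(2,5))

text \<open>Change of variables: the image of the spectral measure under the dual action has the
  Fourier coefficients \<open>\<psi> (A *v k)\<close>. Linearity in f reduces this to a
  cosine.\<close>

lemma spectral_mean_dual_action:
  assumes "even_function \<psi>" "cos_poly f"
  shows "spectral_mean \<psi> (\<lambda>\<theta>. f (dual_action A \<theta>)) = spectral_mean (\<lambda>k. \<psi> (A *v k)) f"
proof -
  have *: "even_function (\<lambda>k. \<psi> (A *v k))"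
  proof -
    have "A *v (- k) = - (A *v k)" for k
      by (simp add: matrix_vector_mult_def vec_eq_iff sum_negf)
    then show ?thesis using assms(1) by (simp add: even_function_def)
  qed
  show ?thesis using assms(2)
    by (induction rule: cos_poly.induct)
       (simp_all add: pairing_dual_action spectral_mean_cos spectral_mean_add spectral_mean_cmult
          cos_poly_dual_action assms(1) *)
qed

lemma spectral_mean_lincomb:
  assumes "even_function \<psi>" "even_function \<psi>'" "cos_poly f"
  shows "spectral_mean (\<lambda>k. a * \<psi> k + b * \<psi>' k) f = a * spectral_mean \<psi> f + b * spectral_mean \<psi>' f"
proof -
  have *: "even_function (\<lambda>k. a * \<psi> k + b * \<psi>' k)"
    using assms(1,2) by (simp add: even_function_def)
  show ?thesis using assms(3)
    by (induction rule: cos_poly.induct)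
       (simp_all add: spectral_mean_cos spectral_mean_add spectral_mean_cmult assms(1,2) * algebra_simps)
qed

section \<open>Almost invariance\<close>

text \<open>Invariance under inversion replaces the hermitian symmetry of complex positive definite
  functions, so that all further estimates are real.\<close>

definition real_pd_on :: "('a, 'b) monoid_scheme \<Rightarrow> ('a \<Rightarrow> real) \<Rightarrow> bool"
  where "real_pd_on G r \<longleftrightarrow> (\<forall>g\<in>carrier G. r (inv\<^bsub>G\<^esub> g) = r g) \<and>
    (\<forall>(n::nat) g x. (\<forall>i<n. g i \<in> carrier G) \<longrightarrow>
      0 \<le> (\<Sum>i<n. \<Sum>j<n. x i * x j * r (inv\<^bsub>G\<^esub> (g i) \<otimes>\<^bsub>G\<^esub> g j)))"

lemma real_pd_on_finite:
  assumes "real_pd_on G r" "finite I" "\<And>i. i \<in> I \<Longrightarrow> g i \<in> carrier G"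
  shows "0 \<le> (\<Sum>i\<in>I. \<Sum>j\<in>I. x i * x j * r (inv\<^bsub>G\<^esub> (g i) \<otimes>\<^bsub>G\<^esub> g j))"
proof -
  obtain e where e: "bij_betw e {..<card I} I"
    using ex_bij_betw_nat_finite[OF assms(2)] by (auto simp: lessThan_atLeast0)
  then have "\<forall>i<card I. g (e i) \<in> carrier G"
    using assms(3) bij_betwE by fastforce
  then have "0 \<le> (\<Sum>i<card I. \<Sum>j<card I. x (e i) * x (e j) * r (inv\<^bsub>G\<^esub> (g (e i)) \<otimes>\<^bsub>G\<^esub> g (e j)))"
    by (intro assms(1)[unfolded real_pd_on_def, THEN conjunct2, rule_format,
          of "card I" "\<lambda>i. g (e i)" "\<lambda>i. x (e i)"]) simp
  also have "\<dots> = (\<Sum>i<card I. \<Sum>j\<in>I. x (e i) * x j * r (inv\<^bsub>G\<^esub> (g (e i)) \<otimes>\<^bsub>G\<^esub> g j))"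
    by (rule sum.cong[OF refl]) (rule sum.reindex_bij_betw[OF e])
  also have "\<dots> = (\<Sum>i\<in>I. \<Sum>j\<in>I. x i * x j * r (inv\<^bsub>G\<^esub> (g i) \<otimes>\<^bsub>G\<^esub> g j))"
    by (rule sum.reindex_bij_betw[OF e])
  finally show ?thesis .
qed

text \<open>Averaging with the inverse makes the symmetry immediate. It preserves positivity because
  exchanging i and j turns one quadratic form into the other.\<close>

lemma real_pd_on_symmetrization:
  assumes "group G" "positive_definite G \<phi>"
  shows "real_pd_on G (\<lambda>g. (Re (\<phi> g) + Re (\<phi> (inv\<^bsub>G\<^esub> g))) / 2)"
proof -
  interpret group G by fact
  have "0 \<le> (\<Sum>i<n. \<Sum>j<n. x i * x j * ((Re (\<phi> (inv\<^bsub>G\<^esub> (g i) \<otimes>\<^bsub>G\<^esub> g j))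
      + Re (\<phi> (inv\<^bsub>G\<^esub> (inv\<^bsub>G\<^esub> (g i) \<otimes>\<^bsub>G\<^esub> g j)))) / 2))"
    if g: "\<forall>i<n. g i \<in> carrier G" for n :: nat and g x
  proof -
    let ?s = "\<Sum>i<n. \<Sum>j<n. x i * x j * Re (\<phi> (inv\<^bsub>G\<^esub> (g i) \<otimes>\<^bsub>G\<^esub> g j))"
    have "(\<Sum>i<n. \<Sum>j<n. cnj (of_real (x i)) * of_real (x j) * \<phi> (inv\<^bsub>G\<^esub> (g i) \<otimes>\<^bsub>G\<^esub> g j)) \<in> \<real>\<^sub>\<ge>\<^sub>0"
      using g by (intro assms(2)[unfolded positive_definite_def, rule_format, of n g "\<lambda>i. of_real (x i)"]) simp
    then have "0 \<le> Re (\<Sum>i<n. \<Sum>j<n. cnj (of_real (x i)) * of_real (x j) * \<phi> (inv\<^bsub>G\<^esub> (g i) \<otimes>\<^bsub>G\<^esub> g j))"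
      by (simp only: complex_nonneg_Reals_iff)
    moreover have "Re (cnj (of_real a) * of_real b * z) = a * b * Re z" for a b z
      by simp
    ultimately have s: "0 \<le> ?s" by (simp only: Re_sum)
    have "?s = (\<Sum>i<n. \<Sum>j<n. x i * x j * Re (\<phi> (inv\<^bsub>G\<^esub> (inv\<^bsub>G\<^esub> (g i) \<otimes>\<^bsub>G\<^esub> g j))))"
    proof (subst sum.swap, intro sum.cong refl)
      fix i j assume "i \<in> {..<n}" "j \<in> {..<n}"
      then have "inv\<^bsub>G\<^esub> (inv\<^bsub>G\<^esub> (g i) \<otimes>\<^bsub>G\<^esub> g j) = inv\<^bsub>G\<^esub> (g j) \<otimes>\<^bsub>G\<^esub> g i"
        using g by (simp add: inv_mult_group)
      then show "x j * x i * Re (\<phi> (inv\<^bsub>G\<^esub> (g j) \<otimes>\<^bsub>G\<^esub> g i))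
          = x i * x j * Re (\<phi> (inv\<^bsub>G\<^esub> (inv\<^bsub>G\<^esub> (g i) \<otimes>\<^bsub>G\<^esub> g j)))"
        by (simp only: mult.commute)
    qed
    then have "(\<Sum>i<n. \<Sum>j<n. x i * x j * ((Re (\<phi> (inv\<^bsub>G\<^esub> (g i) \<otimes>\<^bsub>G\<^esub> g j))
      + Re (\<phi> (inv\<^bsub>G\<^esub> (inv\<^bsub>G\<^esub> (g i) \<otimes>\<^bsub>G\<^esub> g j)))) / 2)) = (?s + ?s) / 2"
      by (simp only: times_divide_eq_right distrib_left sum.distrib sum_divide_distrib[symmetric])
    then show ?thesis using s by simp
  qed
  moreover have "(Re (\<phi> (inv\<^bsub>G\<^esub> g)) + Re (\<phi> (inv\<^bsub>G\<^esub> (inv\<^bsub>G\<^esub> g)))) / 2 = (Re (\<phi> g) + Re (\<phi> (inv\<^bsub>G\<^esub> g))) / 2"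
    if "g \<in> carrier G" for g
    using that by simp
  ultimately show ?thesis unfolding real_pd_on_def by blast
qed

text \<open>With \<open>\<xi>\<close> the cyclic vector of the representation \<open>\<pi>\<close> given by \<open>r\<close>, the matrix coefficient of
  \<open>x \<xi> + y \<pi>(g) \<xi>\<close> restricted to \<open>\<int>\<^sup>n\<close>.\<close>

definition coefficient ::
    "('a, 'b) monoid_scheme \<Rightarrow> ('a \<Rightarrow> real) \<Rightarrow> (int ^ 'n \<Rightarrow> 'a) \<Rightarrow> 'a \<Rightarrow> real \<Rightarrow> real \<Rightarrow> int ^ 'n \<Rightarrow> real"
  where "coefficient G r \<iota> g x y k =
    x * x * r (\<iota> k) + x * y * (r (\<iota> k \<otimes>\<^bsub>G\<^esub> g) + r (inv\<^bsub>G\<^esub> g \<otimes>\<^bsub>G\<^esub> \<iota> k))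
      + y * y * r (inv\<^bsub>G\<^esub> g \<otimes>\<^bsub>G\<^esub> \<iota> k \<otimes>\<^bsub>G\<^esub> g)"

text \<open>The ambient group stays abstract because the larger subgroup is not known explicitly:
  only the lattice, some shears and one further element in it are available.\<close>

locale lattice_in_group = group G for G :: "('a, 'b) monoid_scheme" (structure) +
  fixes \<iota> :: "int ^ 'n::finite \<Rightarrow> 'a"
  assumes \<iota>_closed [simp]: "\<iota> k \<in> carrier G"
    and \<iota>_add: "\<iota> (k + l) = \<iota> k \<otimes> \<iota> l"
begin

lemma \<iota>_0 [simp]: "\<iota> 0 = \<one>"
  using \<iota>_add[of 0 0] by (simp add: l_cancel_one)

lemma \<iota>_minus: "\<iota> (- k) = inv (\<iota> k)"
  using \<iota>_add[of "- k" k] by (intro inv_equality[symmetric]) simp_all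

lemma even_coefficient:
  assumes r: "real_pd_on G r" and g: "g \<in> carrier G"
  shows "even_function (coefficient G r \<iota> g x y)"
proof -
  have inv: "r (inv h) = r h" if "h \<in> carrier G" for h
    using r that by (simp add: real_pd_on_def)
  have "r (inv (\<iota> k) \<otimes> g) = r (inv g \<otimes> \<iota> k)" for k
    using inv[of "inv (\<iota> k) \<otimes> g"] g by (simp add: inv_mult_group)
  moreover have "r (inv g \<otimes> inv (\<iota> k)) = r (\<iota> k \<otimes> g)" for k
    using inv[of "\<iota> k \<otimes> g"] g by (simp add: inv_mult_group)
  moreover have "r (inv g \<otimes> inv (\<iota> k) \<otimes> g) = r (inv g \<otimes> \<iota> k \<otimes> g)" for k
    using inv[of "inv g \<otimes> \<iota> k \<otimes> g"] g by (simp add: inv_mult_group m_assoc)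
  ultimately show ?thesis
    by (simp add: even_function_def coefficient_def \<iota>_minus inv)
qed

text \<open>The positivity of r is applied to the elements \<open>\<iota> a \<otimes> u b\<close>,
  indexed by a in \<open>F\<close> and a boolean b that selects \<one> or g, with the product
  coefficients \<open>c a * z b\<close>.\<close>

lemma positive_definite_coefficient:
  assumes r: "real_pd_on G r" and g: "g \<in> carrier G"
  shows "positive_definite_real (coefficient G r \<iota> g x y)"
  unfolding positive_definite_real_def
proof (intro allI impI)
  fix F and c :: "int ^ 'n \<Rightarrow> real" assume F: "finite (F :: (int ^ 'n) set)"
  define u where "u b = (if b then g else \<one>)" for b
  define z where "z b = (if b then y else x)" for b
  have u: "u b \<in> carrier G" for b using g by (simp add: u_def)
  have r_coeff: "r (inv (\<iota> k \<otimes> u b) \<otimes> (\<iota> l \<otimes> u b')) = r (inv (u b) \<otimes> \<iota> (l - k) \<otimes> u b')" for k l b b'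
  proof -
    have "\<iota> (l - k) = inv (\<iota> k) \<otimes> \<iota> l" using \<iota>_add[of "- k" l] by (simp add: \<iota>_minus)
    then show ?thesis using u by (simp add: inv_mult_group m_assoc)
  qed
  have "0 \<le> (\<Sum>p\<in>F \<times> UNIV. \<Sum>q\<in>F \<times> UNIV. (c (fst p) * z (snd p)) * (c (fst q) * z (snd q)) *
      r (inv (\<iota> (fst p) \<otimes> u (snd p)) \<otimes> (\<iota> (fst q) \<otimes> u (snd q))))"
    by (rule real_pd_on_finite[OF r]) (use F u in auto)
  also have "\<dots> = (\<Sum>a\<in>F. \<Sum>b\<in>UNIV. \<Sum>a'\<in>F. \<Sum>b'\<in>UNIV. (c a * z b) * (c a' * z b') *
      r (inv (u b) \<otimes> \<iota> (a' - a) \<otimes> u b'))"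
    by (simp add: sum.cartesian_product' r_coeff)
  also have "\<dots> = (\<Sum>a\<in>F. \<Sum>a'\<in>F. \<Sum>b\<in>UNIV. \<Sum>b'\<in>UNIV. (c a * z b) * (c a' * z b') *
      r (inv (u b) \<otimes> \<iota> (a' - a) \<otimes> u b'))"
    by (rule sum.cong[OF refl], rule sum.swap)
  also have "\<dots> = (\<Sum>a\<in>F. \<Sum>a'\<in>F. c a * c a' * coefficient G r \<iota> g x y (a' - a))"
    using g by (intro sum.cong refl) (simp add: UNIV_bool u_def z_def coefficient_def algebra_simps)
  finally show "0 \<le> (\<Sum>a\<in>F. \<Sum>b\<in>F. c a * c b * coefficient G r \<iota> g x y (b - a))" .
qed

lemma coefficient_1_0: "coefficient G r \<iota> g 1 0 = (\<lambda>k. r (\<iota> k))"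
  by (simp add: coefficient_def fun_eq_iff)

lemma even_restriction: "real_pd_on G r \<Longrightarrow> even_function (\<lambda>k. r (\<iota> k))"
  using even_coefficient[of r \<one> 1 0] by (simp add: coefficient_1_0)

lemma positive_definite_restriction: "real_pd_on G r \<Longrightarrow> positive_definite_real (\<lambda>k. r (\<iota> k))"
  using positive_definite_coefficient[of r \<one> 1 0] by (simp add: coefficient_1_0)

text \<open>This is \<open>\<parallel>\<pi>(g) \<xi>\<parallel>\<^sup>2 \<le> 2 \<parallel>\<xi>\<parallel>\<^sup>2 + 2 \<parallel>\<pi>(g) \<xi> - \<xi>\<parallel>\<^sup>2\<close> in the seminorm defined by the positive operator
  \<open>\<pi>(f)\<close>, where the defect of the inequality is the square of \<open>2 \<xi> - \<pi>(g) \<xi>\<close>.\<close>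

lemma spectral_mean_almost_invariant:
  assumes r: "real_pd_on G r" and h: "h \<in> carrier G"
    and A: "\<And>k. h \<otimes> \<iota> k = \<iota> (A *v k) \<otimes> h"
    and f: "cos_poly f" "\<And>\<theta>. 0 \<le> f \<theta>" "\<And>\<theta>. f \<theta> \<le> 1"
  shows "spectral_mean (\<lambda>k. r (\<iota> k)) (\<lambda>\<theta>. f (dual_action A \<theta>))
    \<le> 2 * spectral_mean (\<lambda>k. r (\<iota> k)) f + 4 * (r \<one> - r h)"
proof -
  define \<psi> where "\<psi> k = r (\<iota> k)" for k
  \<comment> \<open>With the inverse, the last term of the coefficient is conjugation by h, that is
    \<open>\<psi> (A *v k)\<close>.\<close>
  define g where "g = inv h"
  have g: "g \<in> carrier G" using h by (simp add: g_def)
  define \<chi>1 where "\<chi>1 = coefficient G r \<iota> g 1 (-1)"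
  define \<chi>2 where "\<chi>2 = coefficient G r \<iota> g 2 (-1)"
  have ev: "even_function \<psi>" "even_function \<chi>1" "even_function \<chi>2"
    and pd: "positive_definite_real \<chi>1" "positive_definite_real \<chi>2"
    unfolding \<psi>_def[abs_def] \<chi>1_def \<chi>2_def
    using r g even_restriction even_coefficient positive_definite_coefficient by auto
  have conj: "r (inv g \<otimes> \<iota> k \<otimes> g) = \<psi> (A *v k)" for k
    using A[of k] h by (simp add: g_def \<psi>_def m_assoc)
  have eq: "\<psi> (A *v k) = 1 * (2 * \<psi> k + 2 * \<chi>1 k) + (-1) * \<chi>2 k" for k
    unfolding \<chi>1_def \<chi>2_def coefficient_def conj by (simp add: \<psi>_def)
  have ev2: "even_function (\<lambda>k. 2 * \<psi> k + 2 * \<chi>1 k)"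
    using ev by (simp add: even_function_def)
  have "spectral_mean \<psi> (\<lambda>\<theta>. f (dual_action A \<theta>)) = spectral_mean (\<lambda>k. \<psi> (A *v k)) f"
    by (rule spectral_mean_dual_action[OF ev(1) f(1)])
  also have "\<dots> = 2 * spectral_mean \<psi> f + 2 * spectral_mean \<chi>1 f - spectral_mean \<chi>2 f"
    unfolding eq spectral_mean_lincomb[OF ev2 ev(3) f(1)] spectral_mean_lincomb[OF ev(1,2) f(1)] by simp
  finally have "spectral_mean \<psi> (\<lambda>\<theta>. f (dual_action A \<theta>))
      = 2 * spectral_mean \<psi> f + 2 * spectral_mean \<chi>1 f - spectral_mean \<chi>2 f" .
  moreover have "spectral_mean \<chi>2 f \<ge> 0"
    using spectral_mean_mono[OF ev(3) pd(2) cos_poly_const[of 0] f(1,2)]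
    by (simp add: spectral_mean_const[OF ev(3)])
  moreover have "spectral_mean \<chi>1 f \<le> \<chi>1 0"
    using spectral_mean_mono[OF ev(2) pd(1) f(1) cos_poly_const[of 1] f(3)]
    by (simp add: spectral_mean_const[OF ev(2)])
  moreover have "\<chi>1 0 = 2 * (r \<one> - r h)"
    using r h by (simp add: \<chi>1_def coefficient_def g_def real_pd_on_def)
  ultimately show ?thesis unfolding \<psi>_def by linarith
qed

end

section \<open>Trigonometric inequalities\<close>

text \<open>Measures the distance of an angle to the multiples of 2 pi. It is subadditive, and its
  square is a trigonometric polynomial, so it serves both the geometric estimates and the test
  functions.\<close>

definition chord :: "real \<Rightarrow> real"
  where "chord \<alpha> = cmod (1 - cis \<alpha>)"

lemma chord_nonneg [simp]: "0 \<le> chord \<alpha>"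
  by (simp add: chord_def)

lemma chord_power2: "(chord \<alpha>)\<^sup>2 = 2 - 2 * cos \<alpha>"
proof -
  have "(chord \<alpha>)\<^sup>2 = (1 - cos \<alpha>)\<^sup>2 + (sin \<alpha>)\<^sup>2"
    by (simp add: chord_def cmod_def)
  also have "\<dots> = 2 - 2 * cos \<alpha>"
    using sin_cos_squared_add[of \<alpha>] by (simp add: power2_eq_square algebra_simps)
  finally show ?thesis .
qed

lemma chord_minus [simp]: "chord (- \<alpha>) = chord \<alpha>"
  by (rule power2_eq_imp_eq) (simp_all add: chord_power2)

lemma chord_0 [simp]: "chord 0 = 0"
  by (simp add: chord_def)

lemma chord_add: "chord (\<alpha> + \<beta>) \<le> chord \<alpha> + chord \<beta>"
proof -
  have "1 - cis (\<alpha> + \<beta>) = (1 - cis \<alpha>) + cis \<alpha> * (1 - cis \<beta>)"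
    by (simp add: cis_mult[symmetric] algebra_simps)
  then have "chord (\<alpha> + \<beta>) \<le> cmod (1 - cis \<alpha>) + cmod (cis \<alpha> * (1 - cis \<beta>))"
    unfolding chord_def by (metis norm_triangle_ineq)
  then show ?thesis by (simp add: chord_def norm_mult)
qed

lemma chord_diff: "chord (\<alpha> - \<beta>) \<le> chord \<alpha> + chord \<beta>"
  using chord_add[of \<alpha> "- \<beta>"] by simp

lemma chord_nat_mult_le: "chord (real n * \<alpha>) \<le> real n * chord \<alpha>"
proof (induction n)
  case (Suc n)
  have "chord (real (Suc n) * \<alpha>) \<le> chord (real n * \<alpha>) + chord \<alpha>"
    using chord_add[of "real n * \<alpha>" \<alpha>] by (simp add: algebra_simps)
  with Suc show ?case by (simp add: algebra_simps)
qed simp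

lemma chord_int_mult: "chord (of_int j * \<alpha>) = chord (real (nat \<bar>j\<bar>) * \<alpha>)"
  using chord_minus[of "of_int j * \<alpha>"] by (cases "j \<ge> 0") simp_all

lemma chord_int_mult_le: "chord (of_int j * \<alpha>) \<le> of_int \<bar>j\<bar> * chord \<alpha>"
  using chord_nat_mult_le[of "nat \<bar>j\<bar>" \<alpha>] by (simp add: chord_int_mult)

lemma chord_sum: "chord (\<Sum>i\<in>I. f i) \<le> (\<Sum>i\<in>I. chord (f i))"
proof (induction I rule: infinite_finite_induct)
  case (insert i I)
  then show ?case using chord_add[of "f i" "\<Sum>i\<in>I. f i"] by simp
qed simp_all

text \<open>The k-th summand differs from 1 by at most k times the chord, so the whole sum differs
  from N by at most N / 2.\<close>

lemma norm_sum_cis_ge: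
  assumes "real N * chord \<alpha> \<le> 1"
  shows "real N / 2 \<le> cmod (\<Sum>k<N. cis (real k * \<alpha>))"
proof -
  have "cmod (\<Sum>k<N. 1 - cis (real k * \<alpha>)) \<le> (\<Sum>k<N. chord (real k * \<alpha>))"
    unfolding chord_def by (rule norm_sum)
  also have "\<dots> \<le> (\<Sum>k<N. real k * chord \<alpha>)"
    by (intro sum_mono chord_nat_mult_le)
  also have "\<dots> = (\<Sum>k<N. real k) * chord \<alpha>"
    by (rule sum_distrib_right[symmetric])
  also have "(\<Sum>k<N. real k) \<le> real N * real N / 2"
    by (induction N) (simp_all add: algebra_simps)
  then have "(\<Sum>k<N. real k) * chord \<alpha> \<le> real N * real N / 2 * chord \<alpha>"
    by (rule mult_right_mono) simp
  also have "\<dots> = real N / 2 * (real N * chord \<alpha>)" by simp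
  also have "\<dots> \<le> real N / 2 * 1" using assms by (intro mult_left_mono) simp_all
  finally have "cmod (of_nat N - (\<Sum>k<N. cis (real k * \<alpha>))) \<le> real N / 2"
    by (simp add: sum_subtractf)
  moreover have "cmod (of_nat N) - cmod (\<Sum>k<N. cis (real k * \<alpha>)) \<le> cmod (of_nat N - (\<Sum>k<N. cis (real k * \<alpha>)))"
    by (rule norm_triangle_ineq2)
  ultimately show ?thesis by simp
qed

text \<open>A converse to \<open>chord_nat_mult_le\<close> up to the factor 2, valid while the
  multiples do not wrap around the circle; it follows by factoring
  \<open>1 - cis \<alpha> ^ n\<close>.\<close>

lemma chord_nat_mult_ge:
  assumes "real n * chord \<alpha> \<le> 1"
  shows "real n * chord \<alpha> / 2 \<le> chord (real n * \<alpha>)"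
proof -
  have "1 - cis \<alpha> ^ n = (1 - cis \<alpha>) * (\<Sum>k<n. cis \<alpha> ^ k)"
    by (rule one_diff_power_eq)
  then have "chord (real n * \<alpha>) = chord \<alpha> * cmod (\<Sum>k<n. cis (real k * \<alpha>))"
    by (simp add: chord_def Complex.DeMoivre norm_mult)
  moreover have "chord \<alpha> * (real n / 2) \<le> chord \<alpha> * cmod (\<Sum>k<n. cis (real k * \<alpha>))"
    using norm_sum_cis_ge[OF assms] by (rule mult_left_mono) simp
  ultimately show ?thesis by (simp add: mult.commute)
qed

text \<open>A polynomial substitute for 1 / t, obtained by truncating its expansion at t =
  1.\<close>

definition geometric_sum :: "nat \<Rightarrow> real \<Rightarrow> real"
  where "geometric_sum K t = (\<Sum>k<K. (1 - t) ^ k)"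

lemma mult_geometric_sum: "t * geometric_sum K t = 1 - (1 - t) ^ K"
  using one_diff_power_eq[of "1 - t" K] by (simp add: geometric_sum_def)

lemma geometric_sum_nonneg: "t \<le> 1 \<Longrightarrow> 0 \<le> geometric_sum K t"
  unfolding geometric_sum_def by (intro sum_nonneg) simp

lemma mult_geometric_sum_le_1: "t \<le> 1 \<Longrightarrow> t * geometric_sum K t \<le> 1"
  by (simp add: mult_geometric_sum)

lemma geometric_sum_antimono: "s \<le> t \<Longrightarrow> t \<le> 1 \<Longrightarrow> geometric_sum K t \<le> geometric_sum K s"
  unfolding geometric_sum_def by (intro sum_mono power_mono) simp_all

text \<open>The analogue of 1 / s \<le> C / t, with C independent of K. For s < t it holds because
  \<open>t * geometric_sum K t\<close> increases with t, although the geometric sum itself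
  decreases.\<close>

lemma geometric_sum_le_mult:
  assumes "0 \<le> s" "s \<le> 1" "t \<le> 1" "t \<le> C * s" "1 \<le> C"
  shows "geometric_sum K s \<le> C * geometric_sum K t"
proof (cases "t \<le> s")
  case True
  have "geometric_sum K s \<le> geometric_sum K t"
    using True assms by (intro geometric_sum_antimono) auto
  also have "\<dots> \<le> C * geometric_sum K t"
    using assms mult_right_mono[of 1 C "geometric_sum K t"] geometric_sum_nonneg by simp
  finally show ?thesis .
next
  case False
  then have "s > 0" using assms by (cases "s = 0") auto
  have "s * geometric_sum K s \<le> t * geometric_sum K t"
    unfolding mult_geometric_sum using False assms by (simp add: power_mono)
  also have "\<dots> \<le> C * s * geometric_sum K t"
    using assms by (intro mult_right_mono geometric_sum_nonneg)
  finally show ?thesis using \<open>s > 0\<close> by (simp add: mult.assoc mult.left_commute[of C s])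
qed

text \<open>As a squared chord is at most 4, the normalization keeps every total weight in [0, 1],
  where the geometric sums are nonnegative and the powers decrease.\<close>

definition weight :: "('n::finite \<Rightarrow> real) \<Rightarrow> 'n \<Rightarrow> real"
  where "weight \<theta> i = (chord (\<theta> i))\<^sup>2 / (4 * real CARD('n))"

definition total_weight :: "'n::finite set \<Rightarrow> ('n \<Rightarrow> real) \<Rightarrow> real"
  where "total_weight I \<theta> = (\<Sum>i\<in>I. weight \<theta> i)"

lemma weight_nonneg [simp]: "0 \<le> weight \<theta> i"
  by (simp add: weight_def)

lemma weight_le: "weight (\<theta> :: 'n::finite \<Rightarrow> real) i \<le> 1 / real CARD('n)"
proof -
  have "(chord (\<theta> i))\<^sup>2 \<le> 4" unfolding chord_power2 using cos_ge_minus_one[of "\<theta> i"] by linarith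
  then show ?thesis by (simp add: weight_def field_simps)
qed

lemma total_weight_nonneg [simp]: "0 \<le> total_weight I \<theta>"
  by (simp add: total_weight_def sum_nonneg)

lemma weight_le_total_weight: "i \<in> I \<Longrightarrow> weight \<theta> i \<le> total_weight I \<theta>"
  unfolding total_weight_def by (intro member_le_sum) simp_all

lemma total_weight_le_1 [simp]: "total_weight I (\<theta> :: 'n::finite \<Rightarrow> real) \<le> 1"
proof -
  have "total_weight I \<theta> \<le> (\<Sum>i\<in>I. 1 / real CARD('n))"
    unfolding total_weight_def by (intro sum_mono weight_le)
  also have "\<dots> \<le> real CARD('n) * (1 / real CARD('n))"
    by (simp add: card_mono divide_right_mono)
  finally show ?thesis by simp
qed

text \<open>A truncation of \<open>weight \<theta> i / total_weight I \<theta>\<close> that is a trigonometric polynomial.\<close>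

definition slope :: "nat \<Rightarrow> 'n::finite set \<Rightarrow> 'n \<Rightarrow> ('n \<Rightarrow> real) \<Rightarrow> real"
  where "slope K I i \<theta> = weight \<theta> i * geometric_sum K (total_weight I \<theta>)"

lemma slope_nonneg: "0 \<le> slope K I i \<theta>"
  by (simp add: slope_def geometric_sum_nonneg)

lemma slope_le_1:
  assumes "i \<in> I"
  shows "slope K I i \<theta> \<le> 1"
proof -
  have "slope K I i \<theta> \<le> total_weight I \<theta> * geometric_sum K (total_weight I \<theta>)"
    unfolding slope_def using assms by (intro mult_right_mono weight_le_total_weight geometric_sum_nonneg) simp_all
  also have "\<dots> \<le> 1" by (simp add: mult_geometric_sum_le_1)
  finally show ?thesis .
qed

lemma sum_slope: "(\<Sum>i\<in>I. slope K I i \<theta>) = 1 - (1 - total_weight I \<theta>) ^ K"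
  by (simp add: slope_def total_weight_def mult_geometric_sum flip: sum_distrib_right)

lemma pairing_axis [simp]: "pairing (axis i c) \<theta> = of_int c * \<theta> i"
proof -
  have "of_int (axis i c $ j) * \<theta> j = (if j = i then of_int c * \<theta> i else 0)" for j
    by (simp add: axis_def)
  then show ?thesis by (simp add: pairing_def)
qed

lemma cos_poly_weight: "cos_poly (\<lambda>\<theta>. weight \<theta> (i :: 'n::finite))"
proof -
  have "cos_poly (\<lambda>\<theta> :: 'n \<Rightarrow> real. 1 / (4 * real CARD('n)) * (2 - 2 * cos (pairing (axis i 1) \<theta>)))"
    by (intro cos_poly_cmult cos_poly_diff cos_poly_const cos_poly_cos)
  then show ?thesis by (simp add: weight_def chord_power2)
qed

lemma cos_poly_total_weight: "cos_poly (total_weight I)"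
  unfolding total_weight_def[abs_def] by (intro cos_poly_sum cos_poly_weight)

lemma cos_poly_slope: "cos_poly (slope K I i)"
  unfolding slope_def[abs_def] geometric_sum_def
  by (intro cos_poly_mult cos_poly_weight cos_poly_sum cos_poly_power cos_poly_diff cos_poly_const
      cos_poly_total_weight)

text \<open>Among the \<open>m\<close> translates of \<open>\<theta> d\<close> by multiples of \<open>4 m \<theta> i\<close>, at most one is within \<open>m chord (\<theta> i)\<close>
  of \<open>0\<close>, unless \<open>\<theta> i\<close> itself is not small.\<close>

lemma sum_slope_shear:
  fixes i d :: "'n::finite" and m :: nat
  assumes "i \<noteq> d" "i \<in> I" "d \<in> I" "m \<ge> 1"
  shows "(\<Sum>l<m. slope K I i (\<theta>(d := \<theta> d + real (4 * m * l) * \<theta> i)))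
    \<le> 2 + 64 * real m ^ 5 * real CARD('n) * weight \<theta> i"
proof -
  define \<theta>' where "\<theta>' l = \<theta>(d := \<theta> d + real (4 * m * l) * \<theta> i)" for l
  define \<sigma> where "\<sigma> = chord (\<theta> i)"
  have w: "weight (\<theta>' l) i = weight \<theta> i" for l
    using assms by (simp add: \<theta>'_def weight_def)
  have pos: "0 \<le> 64 * real m ^ 5 * real CARD('n) * weight \<theta> i" by simp
  \<comment> \<open>Two translates differ by at most \<open>4 * m\<^sup>2\<close> multiples of
    \<open>\<theta> i\<close>, so the last case excludes wrapping around. In the middle case the
    trivial bound m is at most \<open>m * (4 * m\<^sup>2 * \<sigma>)\<^sup>2\<close>, which is where
    the term with \<open>64 * m ^ 5\<close> comes from.\<close>
  consider "\<sigma> = 0" | "\<sigma> > 0" "4 * (real m)\<^sup>2 * \<sigma> > 1" | "\<sigma> > 0" "4 * (real m)\<^sup>2 * \<sigma> \<le> 1"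
    unfolding \<sigma>_def using chord_nonneg[of "\<theta> i"] by linarith
  then have "(\<Sum>l<m. slope K I i (\<theta>' l)) \<le> 2 + 64 * real m ^ 5 * real CARD('n) * weight \<theta> i"
  proof cases
    case 1
    then have "slope K I i (\<theta>' l) = 0" for l
      by (simp add: slope_def w) (simp add: weight_def \<sigma>_def)
    then show ?thesis using pos by simp
  next
    case 2
    have "(\<Sum>l<m. slope K I i (\<theta>' l)) \<le> (\<Sum>l<m. 1)"
      using assms by (intro sum_mono slope_le_1)
    also have "\<dots> \<le> real m * (4 * (real m)\<^sup>2 * \<sigma>)\<^sup>2"
      using 2 mult_left_mono[of 1 "(4 * (real m)\<^sup>2 * \<sigma>)\<^sup>2" "real m"] by (simp add: one_le_power)
    also have "\<dots> = 64 * real m ^ 5 * real CARD('n) * weight \<theta> i"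
      by (simp add: weight_def \<sigma>_def power_mult_distrib eval_nat_numeral)
    finally show ?thesis by simp
  next
    case 3
    define bad where "bad = {l. l < m \<and> chord (\<theta>' l d) < real m * \<sigma>}"
    \<comment> \<open>The spacing 4 m beats the loss of the factor 2: two translates differ by a
      chord of at least \<open>2 * m * \<sigma>\<close>, but two bad ones by less.\<close>
    have far: False if "l \<in> bad" "l' \<in> bad" "l < l'" for l l'
    proof -
      define j where "j = 4 * m * (l' - l)"
      have "l' - l \<le> m" using that by (auto simp: bad_def)
      then have "j \<le> 4 * m\<^sup>2" by (simp add: j_def power2_eq_square)
      then have "real j \<le> 4 * (real m)\<^sup>2" by (metis of_nat_le_iff of_nat_mult of_nat_numeral of_nat_power)
      then have "real j * \<sigma> \<le> 1"
        using 3 mult_right_mono[of "real j" "4 * (real m)\<^sup>2" \<sigma>] by linarith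
      then have "real j * \<sigma> / 2 \<le> chord (real j * \<theta> i)"
        unfolding \<sigma>_def by (rule chord_nat_mult_ge)
      moreover have "real j * \<theta> i = \<theta>' l' d - \<theta>' l d"
        using that by (simp add: \<theta>'_def j_def of_nat_diff algebra_simps)
      then have "chord (real j * \<theta> i) \<le> chord (\<theta>' l' d) + chord (\<theta>' l d)"
        using chord_diff by simp
      moreover have "4 * m * 1 \<le> j" unfolding j_def using that by (intro mult_left_mono) auto
      then have "4 * real m \<le> real j" by linarith
      then have "4 * real m * \<sigma> \<le> real j * \<sigma>" using 3 by (intro mult_right_mono) auto
      ultimately show False using that by (simp add: bad_def)
    qed
    have "l = l'" if "l \<in> bad" "l' \<in> bad" for l l'
      using far[OF that] far[OF that(2,1)] by (cases l l' rule: linorder_cases) auto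
    moreover have "finite bad" by (simp add: bad_def)
    ultimately have card_bad: "card bad \<le> 1"
      unfolding One_nat_def by (subst card_le_Suc0_iff_eq) auto
    \<comment> \<open>A good translate has \<open>d\<close>-weight at least m times its
      \<open>i\<close>-weight, hence slope at most 1 / m. The m good ones and the single bad one
      contribute at most 1 each in total.\<close>
    have each: "slope K I i (\<theta>' l) \<le> of_bool (l \<in> bad) + 1 / real m" if "l < m" for l
    proof (cases "l \<in> bad")
      case True
      then show ?thesis using slope_le_1[OF assms(2), of K "\<theta>' l"] by (simp add: add_increasing2)
    next
      case False
      define s where "s = chord (\<theta>' l d)"
      have "real m * \<sigma> \<le> s" using False that by (simp add: bad_def s_def)
      then have "(real m * \<sigma>)\<^sup>2 \<le> s\<^sup>2" using 3 by (intro power_mono) auto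
      have "weight (\<theta>' l) i + weight (\<theta>' l) d \<le> total_weight I (\<theta>' l)"
      proof -
        have "weight (\<theta>' l) i + weight (\<theta>' l) d = (\<Sum>k\<in>{i, d}. weight (\<theta>' l) k)"
          using assms by simp
        also have "\<dots> \<le> total_weight I (\<theta>' l)"
          unfolding total_weight_def using assms by (intro sum_mono2) auto
        finally show ?thesis .
      qed
      moreover have "real m * weight (\<theta>' l) i \<le> weight (\<theta>' l) d"
      proof -
        have "real m * \<sigma>\<^sup>2 \<le> (real m * \<sigma>)\<^sup>2"
          unfolding power_mult_distrib using assms(4) by (intro mult_right_mono self_le_power) simp_all
        also have "\<dots> \<le> s\<^sup>2" by fact
        finally show ?thesis
          by (simp add: w) (simp add: weight_def s_def \<sigma>_def divide_right_mono)
      qed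
      ultimately have "real m * weight (\<theta>' l) i \<le> total_weight I (\<theta>' l)"
        using weight_nonneg[of "\<theta>' l" i] by linarith
      then have "real m * slope K I i (\<theta>' l) \<le> total_weight I (\<theta>' l) * geometric_sum K (total_weight I (\<theta>' l))"
        unfolding slope_def mult.assoc[symmetric] by (intro mult_right_mono geometric_sum_nonneg) simp_all
      also have "\<dots> \<le> 1" by (simp add: mult_geometric_sum_le_1)
      finally show ?thesis using False assms(4) by (simp add: pos_le_divide_eq mult.commute)
    qed
    have "(\<Sum>l<m. slope K I i (\<theta>' l)) \<le> (\<Sum>l<m. of_bool (l \<in> bad) + 1 / real m)"
      by (intro sum_mono each) simp
    also have "\<dots> = real (card ({..<m} \<inter> bad)) + 1"
      using assms(4) by (simp add: sum.distrib sum_of_bool_eq)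
    also have "{..<m} \<inter> bad = bad" by (auto simp: bad_def)
    finally have "(\<Sum>l<m. slope K I i (\<theta>' l)) \<le> real (card bad) + 1" .
    moreover have "real (card bad) \<le> 1" using card_bad by simp
    ultimately show ?thesis using pos by linarith
  qed
  then show ?thesis by (simp only: \<theta>'_def)
qed

text \<open>Near \<open>0\<close>, the slopes other than that of \<open>d\<close> are all small only close to the \<open>d\<close>-axis, which the
  dual action of \<open>A\<close> moves away from itself.\<close>

lemma slope_dual_action_bound:
  fixes A :: "int ^ 'n ^ 'n::finite"
  assumes d: "d \<in> I" and i: "i \<in> I - {d}" and A: "A $ d $ i \<noteq> 0"
    and inv: "\<And>k j. k \<notin> I \<Longrightarrow> j \<in> I \<Longrightarrow> A $ k $ j = 0"
  obtains C where "C \<ge> 0"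
    "\<And>K \<theta>. 1 - (1 - total_weight I \<theta>) ^ K
      \<le> C * ((\<Sum>k\<in>I - {d}. slope K I k \<theta>) + slope K I i (dual_action A \<theta>)) + C * total_weight I \<theta>"
proof -
  define M where "M = real CARD('n)"
  have M: "M > 0" by (simp add: M_def)
  define a where "a k j = real_of_int \<bar>A $ k $ j\<bar>" for k j
  have chord_dual: "chord (dual_action A \<theta> j) \<le> (\<Sum>k\<in>I. a k j * chord (\<theta> k))" if "j \<in> I" for \<theta> j
  proof -
    have "dual_action A \<theta> j = (\<Sum>k\<in>I. of_int (A $ k $ j) * \<theta> k)"
      unfolding dual_action_def using inv that by (intro sum.mono_neutral_right) auto
    also have "chord \<dots> \<le> (\<Sum>k\<in>I. chord (of_int (A $ k $ j) * \<theta> k))" by (rule chord_sum)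
    also have "\<dots> \<le> (\<Sum>k\<in>I. a k j * chord (\<theta> k))"
      unfolding a_def by (intro sum_mono chord_int_mult_le)
    finally show ?thesis .
  qed
  have weight_dual: "weight (dual_action A \<theta>) j \<le> (\<Sum>k\<in>I. (a k j)\<^sup>2) * total_weight I \<theta>" if "j \<in> I" for \<theta> j
  proof -
    have "(chord (dual_action A \<theta> j))\<^sup>2 \<le> (\<Sum>k\<in>I. a k j * chord (\<theta> k))\<^sup>2"
      using chord_dual[OF that] by (intro power_mono) auto
    also have "\<dots> \<le> (\<Sum>k\<in>I. (a k j)\<^sup>2) * (\<Sum>k\<in>I. (chord (\<theta> k))\<^sup>2)"
      by (rule Cauchy_Schwarz_ineq_sum)
    finally show ?thesis
      by (simp add: weight_def total_weight_def divide_right_mono flip: sum_divide_distrib)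
  qed
  define C2 where "C2 = 1 + (\<Sum>j\<in>I. \<Sum>k\<in>I. (a k j)\<^sup>2)"
  have C2: "1 \<le> C2" by (simp add: C2_def sum_nonneg)
  have total_dual: "total_weight I (dual_action A \<theta>) \<le> C2 * total_weight I \<theta>" for \<theta>
  proof -
    have "total_weight I (dual_action A \<theta>) \<le> (\<Sum>j\<in>I. (\<Sum>k\<in>I. (a k j)\<^sup>2) * total_weight I \<theta>)"
      unfolding total_weight_def[of I "dual_action A \<theta>"] by (intro sum_mono weight_dual)
    also have "\<dots> \<le> C2 * total_weight I \<theta>"
      by (simp add: C2_def distrib_right sum_distrib_right[symmetric])
    finally show ?thesis .
  qed
  have geo: "geometric_sum K (total_weight I \<theta>) \<le> C2 * geometric_sum K (total_weight I (dual_action A \<theta>))" for K \<theta>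
    using total_dual C2 by (intro geometric_sum_le_mult) simp_all
  define p where "p = a d i"
  have p: "p \<ge> 1" using A by (simp add: p_def a_def)
  define S where "S = 1 + (\<Sum>k\<in>I - {d}. (a k i)\<^sup>2)"
  have S: "S \<ge> 1" by (simp add: S_def sum_nonneg)
  \<comment> \<open>While the multiple \<open>A $ d $ i\<close> of \<open>\<theta> d\<close> does
    not wrap around, \<open>\<theta> d\<close> is controlled by coordinate \<open>i\<close> of the
    image and the other angles in \<open>I\<close>. The 8 arises from
    \<open>(2 * (c + t))\<^sup>2\<close>.\<close>
  have near: "weight \<theta> d \<le> 8 * S * (weight (dual_action A \<theta>) i + (\<Sum>k\<in>I - {d}. weight \<theta> k))"
    if "p * chord (\<theta> d) \<le> 1" for \<theta>
  proof -
    define c where "c = chord (dual_action A \<theta> i)"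
    define t where "t = (\<Sum>k\<in>I - {d}. a k i * chord (\<theta> k))"
    have "real (nat \<bar>A $ d $ i\<bar>) = p" by (simp add: p_def a_def)
    then have "p * chord (\<theta> d) / 2 \<le> chord (of_int (A $ d $ i) * \<theta> d)"
      using chord_nat_mult_ge[of "nat \<bar>A $ d $ i\<bar>" "\<theta> d"] that by (simp add: chord_int_mult)
    also have "of_int (A $ d $ i) * \<theta> d = dual_action A \<theta> i - (\<Sum>k\<in>I - {d}. of_int (A $ k $ i) * \<theta> k)"
    proof -
      have "dual_action A \<theta> i = (\<Sum>k\<in>I. of_int (A $ k $ i) * \<theta> k)"
        unfolding dual_action_def using inv i by (intro sum.mono_neutral_right) auto
      then show ?thesis using d by (simp add: sum.remove[of I d])
    qed
    also have "chord \<dots> \<le> c + chord (\<Sum>k\<in>I - {d}. of_int (A $ k $ i) * \<theta> k)"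
      unfolding c_def by (rule chord_diff)
    also have "chord (\<Sum>k\<in>I - {d}. of_int (A $ k $ i) * \<theta> k) \<le> t"
      unfolding t_def a_def by (intro order_trans[OF chord_sum] sum_mono chord_int_mult_le)
    finally have "p * chord (\<theta> d) \<le> 2 * (c + t)" by simp
    moreover have "chord (\<theta> d) \<le> p * chord (\<theta> d)"
      using p mult_right_mono[of 1 p "chord (\<theta> d)"] by simp
    ultimately have "(chord (\<theta> d))\<^sup>2 \<le> (2 * (c + t))\<^sup>2" by (intro power_mono) auto
    also have "\<dots> \<le> 8 * (c\<^sup>2 + t\<^sup>2)"
      using zero_le_power2[of "c - t"] by (simp add: power2_eq_square algebra_simps)
    also have "t\<^sup>2 \<le> (\<Sum>k\<in>I - {d}. (a k i)\<^sup>2) * (\<Sum>k\<in>I - {d}. (chord (\<theta> k))\<^sup>2)"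
      unfolding t_def by (rule Cauchy_Schwarz_ineq_sum)
    also have "\<dots> \<le> S * (\<Sum>k\<in>I - {d}. (chord (\<theta> k))\<^sup>2)"
      by (intro mult_right_mono) (simp_all add: S_def sum_nonneg)
    also have "c\<^sup>2 \<le> S * c\<^sup>2" using S mult_right_mono[of 1 S "c\<^sup>2"] by simp
    finally have "(chord (\<theta> d))\<^sup>2 \<le> 8 * S * (c\<^sup>2 + (\<Sum>k\<in>I - {d}. (chord (\<theta> k))\<^sup>2))"
      by (simp add: algebra_simps)
    then show ?thesis
      unfolding weight_def M_def[symmetric] c_def[symmetric] sum_divide_distrib[symmetric]
        add_divide_distrib[symmetric] times_divide_eq_right
      using M by (intro divide_right_mono) simp_all
  qed
  \<comment> \<open>The first two summands serve the region near the \<open>d\<close>-hyperplane.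
    The last one serves its complement, where the total weight is at least
    \<open>1 / (4 * M * p\<^sup>2)\<close>.\<close>
  define C where "C = 1 + 8 * S * C2 + 4 * M * p\<^sup>2"
  have C: "C \<ge> 0" "1 \<le> C" "8 * S * C2 + 1 \<le> C" "4 * M * p\<^sup>2 \<le> C"
    using S C2 M by (auto simp: C_def)
  have "1 - (1 - total_weight I \<theta>) ^ K
      \<le> C * ((\<Sum>k\<in>I - {d}. slope K I k \<theta>) + slope K I i (dual_action A \<theta>)) + C * total_weight I \<theta>" for K \<theta>
  proof -
    define Q where "Q = (\<Sum>k\<in>I - {d}. slope K I k \<theta>)"
    define R where "R = slope K I i (dual_action A \<theta>)"
    have nn: "0 \<le> Q" "0 \<le> R" by (simp_all add: Q_def R_def slope_nonneg sum_nonneg)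
    show ?thesis
    proof (cases "p * chord (\<theta> d) \<le> 1")
      case True
      define g where "g = geometric_sum K (total_weight I \<theta>)"
      have g: "0 \<le> g" by (simp add: g_def geometric_sum_nonneg)
      have "1 - (1 - total_weight I \<theta>) ^ K = slope K I d \<theta> + Q"
        using d by (simp add: sum_slope[symmetric] Q_def sum.remove[of I d])
      also have "slope K I d \<theta> \<le> 8 * S * (weight (dual_action A \<theta>) i + (\<Sum>k\<in>I - {d}. weight \<theta> k)) * g"
        unfolding slope_def g_def[symmetric] by (intro mult_right_mono near True g)
      also have "\<dots> = 8 * S * (weight (dual_action A \<theta>) i * g + Q)"
        by (simp add: Q_def slope_def g_def[symmetric] sum_distrib_right distrib_right)
      finally have "1 - (1 - total_weight I \<theta>) ^ K \<le> 8 * S * (weight (dual_action A \<theta>) i * g + Q) + Q"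
        by simp
      also have "8 * S * (weight (dual_action A \<theta>) i * g + Q) \<le> 8 * S * (C2 * (Q + R))"
      proof (rule mult_left_mono)
        have "weight (dual_action A \<theta>) i * g
            \<le> weight (dual_action A \<theta>) i * (C2 * geometric_sum K (total_weight I (dual_action A \<theta>)))"
          unfolding g_def by (intro mult_left_mono geo) simp
        also have "\<dots> = C2 * R" by (simp add: R_def slope_def mult.left_commute)
        finally have "weight (dual_action A \<theta>) i * g \<le> C2 * R" .
        moreover have "Q \<le> C2 * Q" using nn C2 mult_right_mono[of 1 C2 Q] by simp
        ultimately show "weight (dual_action A \<theta>) i * g + Q \<le> C2 * (Q + R)"
          by (simp add: distrib_left)
      qed (use S in simp)
      finally have "1 - (1 - total_weight I \<theta>) ^ K \<le> 8 * S * C2 * (Q + R) + Q"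
        by (simp only: mult.assoc)
      also have "\<dots> \<le> (8 * S * C2 + 1) * (Q + R)" using nn by (simp add: algebra_simps)
      also have "\<dots> \<le> C * (Q + R)" using nn C by (intro mult_right_mono) auto
      also have "\<dots> \<le> C * (Q + R) + C * total_weight I \<theta>" using C by simp
      finally show ?thesis by (simp only: Q_def R_def)
    next
      case False
      have "1 \<le> (p * chord (\<theta> d))\<^sup>2" using False by (simp add: one_le_power)
      also have "\<dots> = 4 * M * p\<^sup>2 * weight \<theta> d"
        by (simp add: weight_def M_def power_mult_distrib)
      also have "\<dots> \<le> C * total_weight I \<theta>"
        using C M d by (intro mult_mono weight_le_total_weight) auto
      finally have "1 \<le> C * total_weight I \<theta>" .
      moreover have "0 \<le> (1 - total_weight I \<theta>) ^ K" by simp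
      moreover have "0 \<le> C * (Q + R)" using nn C by simp
      ultimately show ?thesis unfolding Q_def R_def by linarith
    qed
  qed
  with C(1) show thesis by (rule that)
qed

text \<open>A Fejer kernel in the angle \<open>\<theta> d\<close>, normalized to be 1 at 0. Its
  spectral mean is a double average of values along the axis \<open>d\<close> of the lattice, which
  decay at infinity makes small.\<close>

definition average_kernel :: "nat \<Rightarrow> 'n \<Rightarrow> ('n \<Rightarrow> real) \<Rightarrow> real"
  where "average_kernel N d \<theta> = (\<Sum>k<N. \<Sum>l<N. cos ((real k - real l) * \<theta> d)) / (real N)\<^sup>2"

lemma average_kernel_eq: "average_kernel N d \<theta> = (cmod (\<Sum>k<N. cis (real k * \<theta> d)))\<^sup>2 / (real N)\<^sup>2"
proof -
  have "(cmod (\<Sum>k<N. cis (real k * \<theta> d)))\<^sup>2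
      = (\<Sum>k<N. cos (real k * \<theta> d))\<^sup>2 + (\<Sum>k<N. sin (real k * \<theta> d))\<^sup>2"
    by (simp add: cmod_def sum_nonneg)
  also have "\<dots> = (\<Sum>k<N. \<Sum>l<N. cos ((real k - real l) * \<theta> d))"
    by (simp add: power2_eq_square sum_product sum.distrib[symmetric] left_diff_distrib cos_diff)
  finally show ?thesis by (simp add: average_kernel_def)
qed

lemma cos_poly_average_kernel: "cos_poly (average_kernel N (d :: 'n::finite))"
proof -
  have "average_kernel N d = (\<lambda>\<theta>. 1 / (real N)\<^sup>2 * (\<Sum>k<N. \<Sum>l<N. cos (pairing (axis d (int k - int l)) \<theta>)))"
    by (simp add: average_kernel_def fun_eq_iff)
  then show ?thesis by (simp only:) (intro cos_poly_cmult cos_poly_sum cos_poly_cos)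
qed

text \<open>If the chord of \<open>\<theta> d\<close> is at most 1 / N, the kernel is at least 1 /
  4; otherwise the weight of \<open>d\<close> alone forces geometric decay in K.\<close>

lemma power_one_minus_total_weight_le:
  fixes d :: "'n::finite"
  assumes "d \<in> I" "N \<ge> 1"
  shows "(1 - total_weight I \<theta>) ^ K
    \<le> 4 * average_kernel N d \<theta> + (1 - 1 / (4 * real CARD('n) * (real N)\<^sup>2)) ^ K"
proof (cases "real N * chord (\<theta> d) \<le> 1")
  case True
  have "(real N / 2)\<^sup>2 \<le> (cmod (\<Sum>k<N. cis (real k * \<theta> d)))\<^sup>2"
    using norm_sum_cis_ge[OF True] by (intro power_mono) auto
  then have "1 \<le> 4 * average_kernel N d \<theta>"
    using assms by (simp add: average_kernel_eq power_divide pos_le_divide_eq)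
  moreover have "(1 - total_weight I \<theta>) ^ K \<le> 1" by (simp add: power_le_one)
  moreover have "0 \<le> (1 - 1 / (4 * real CARD('n) * (real N)\<^sup>2)) ^ K"
  proof -
    have "1 \<le> 4 * real CARD('n) * (real N)\<^sup>2"
    proof -
      have "1 \<le> CARD('n)" "1 \<le> N\<^sup>2" using assms by (simp_all add: Suc_leI)
      then have "1 * 1 \<le> real CARD('n) * (real N)\<^sup>2" 
        by (intro mult_mono) (simp_all flip: of_nat_power)
      then show ?thesis by simp
    qed
    then show ?thesis by simp
  qed
  ultimately show ?thesis by linarith
next
  case False
  have "1 \<le> (real N * chord (\<theta> d))\<^sup>2" using False by (simp add: one_le_power)
  then have "1 / (4 * real CARD('n) * (real N)\<^sup>2) \<le> weight \<theta> d"
    using assms by (simp add: weight_def field_simps)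
  also have "\<dots> \<le> total_weight I \<theta>" using assms by (intro weight_le_total_weight)
  finally have "(1 - total_weight I \<theta>) ^ K \<le> (1 - 1 / (4 * real CARD('n) * (real N)\<^sup>2)) ^ K"
    by (intro power_mono) simp_all
  moreover have "0 \<le> average_kernel N d \<theta>" by (simp add: average_kernel_eq)
  ultimately show ?thesis by linarith
qed

section \<open>Lattices moved by shears\<close>

text \<open>Only finitely many arguments carry values of size at least \<epsilon> / 2. For each k
  their total contribution is at most a constant B independent of N, so it vanishes in the
  average.\<close>

lemma double_average_small:
  fixes f :: "int \<Rightarrow> real"
  assumes f: "\<And>\<epsilon>. \<epsilon> > 0 \<Longrightarrow> finite {z. \<bar>f z\<bar> \<ge> \<epsilon>}" and "\<epsilon> > 0"
  obtains N where "N \<ge> 1" "(\<Sum>k<N. \<Sum>l<N. f (int k - int l)) / (real N)\<^sup>2 < \<epsilon>"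
proof -
  define T where "T = {z. \<bar>f z\<bar> \<ge> \<epsilon> / 2}"
  define B where "B = (\<Sum>z\<in>T. \<bar>f z\<bar>)"
  have T: "finite T" unfolding T_def using f[of "\<epsilon> / 2"] \<open>\<epsilon> > 0\<close> by simp
  have inner: "(\<Sum>l<N. f (int k - int l)) \<le> real N * (\<epsilon> / 2) + B" for k N :: nat
  proof -
    define P where "P = {l. l < N \<and> int k - int l \<in> T}"
    have "f (int k - int l) \<le> \<epsilon> / 2 + (if l \<in> P then \<bar>f (int k - int l)\<bar> else 0)" if "l < N" for l
      using that \<open>\<epsilon> > 0\<close> by (auto simp: P_def T_def)
    then have "(\<Sum>l<N. f (int k - int l)) \<le> (\<Sum>l<N. \<epsilon> / 2 + (if l \<in> P then \<bar>f (int k - int l)\<bar> else 0))"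
      by (intro sum_mono) simp
    also have "\<dots> = real N * (\<epsilon> / 2) + (\<Sum>l\<in>P. \<bar>f (int k - int l)\<bar>)"
    proof -
      have "{..<N} \<inter> P = P" by (auto simp: P_def)
      then show ?thesis by (simp add: sum.distrib sum.If_cases)
    qed
    also have "(\<Sum>l\<in>P. \<bar>f (int k - int l)\<bar>) = (\<Sum>z\<in>(\<lambda>l. int k - int l) ` P. \<bar>f z\<bar>)"
      by (subst sum.reindex) (auto simp: inj_on_def)
    also have "\<dots> \<le> B"
      unfolding B_def using T by (intro sum_mono2) (auto simp: P_def)
    finally show ?thesis by simp
  qed
  obtain N where N: "real N > max 1 (2 * B / \<epsilon>)" using reals_Archimedean2 by blast
  then have N1: "real N > 1" "B < real N * (\<epsilon> / 2)" using \<open>\<epsilon> > 0\<close> by (simp_all add: field_simps)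
  have "(\<Sum>k<N. \<Sum>l<N. f (int k - int l)) \<le> (\<Sum>k<N. real N * (\<epsilon> / 2) + B)"
    by (intro sum_mono inner)
  also have "\<dots> = real N * (real N * (\<epsilon> / 2) + B)" by simp
  also have "\<dots> < real N * (real N * \<epsilon>)" using N1 by (intro mult_strict_left_mono) (auto simp: field_simps)
  finally have "(\<Sum>k<N. \<Sum>l<N. f (int k - int l)) / (real N)\<^sup>2 < \<epsilon>"
    using N1 by (simp add: divide_less_eq power2_eq_square mult_ac)
  then show thesis using N1 by (intro that[of N]) auto
qed

definition shear :: "'n::finite \<Rightarrow> 'n \<Rightarrow> int \<Rightarrow> int ^ 'n ^ 'n"
  where "shear i d j = (\<chi> a b. if a = b then 1 else if a = i \<and> b = d then j else 0)"

lemma dual_action_shear: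
  assumes "i \<noteq> d"
  shows "dual_action (shear i d j) \<theta> = \<theta>(d := \<theta> d + of_int j * \<theta> i)"
proof
  fix b
  have "of_int (shear i d j $ a $ b) * \<theta> a
      = (if a = b then \<theta> b else 0) + (if a = i then if b = d then of_int j * \<theta> i else 0 else 0)" for a
    using assms by (auto simp: shear_def)
  then show "dual_action (shear i d j) \<theta> b = (\<theta>(d := \<theta> d + of_int j * \<theta> i)) b"
    by (simp add: dual_action_def sum.distrib)
qed

context lattice_in_group
begin

text \<open>Each of the m sheared slopes has almost at least half the mean of the slope itself,
  while their sum is bounded pointwise. For an almost invariant r concentrated near 0, this leaves a
  mean of about 4 / m. The shears realized in the group have negative parameters because they undo
  those in the sum.\<close>

lemma spectral_mean_slope_le:
  assumes r: "real_pd_on G r" and id: "i \<noteq> d" "i \<in> I" "d \<in> I" and m: "m \<ge> 1"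
    and u: "\<And>l. u l \<in> carrier G" "\<And>l k. u l \<otimes> \<iota> k = \<iota> (shear i d (- int (4 * m * l)) *v k) \<otimes> u l"
  shows "real m * spectral_mean (\<lambda>k. r (\<iota> k)) (slope K I i)
    \<le> 2 * (2 * r \<one> + 64 * real m ^ 5 * real CARD('n) * spectral_mean (\<lambda>k. r (\<iota> k)) (\<lambda>\<theta>. weight \<theta> i))
      + (\<Sum>l<m. 4 * (r \<one> - r (u l)))"
proof -
  define \<psi> where "\<psi> k = r (\<iota> k)" for k
  have ev: "even_function \<psi>" and pd: "positive_definite_real \<psi>"
    unfolding \<psi>_def[abs_def] using r even_restriction positive_definite_restriction by auto
  define c where "c = 64 * real m ^ 5 * real CARD('n)"
  define f where "f l \<theta> = slope K I i (dual_action (shear i d (int (4 * m * l))) \<theta>)" for l \<theta>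
  have f: "cos_poly (f l)" for l
    unfolding f_def[abs_def] by (intro cos_poly_dual_action cos_poly_slope)
  have "spectral_mean \<psi> (slope K I i) \<le> 2 * spectral_mean \<psi> (f l) + 4 * (r \<one> - r (u l))" for l
  proof -
    have "f l (dual_action (shear i d (- int (4 * m * l))) \<theta>) = slope K I i \<theta>" for \<theta>
      using id by (simp add: f_def dual_action_shear)
    then show ?thesis
      using spectral_mean_almost_invariant[OF r u f, of l l]
      by (simp add: \<psi>_def[abs_def] f_def slope_nonneg slope_le_1 id)
  qed
  then have "(\<Sum>l<m. spectral_mean \<psi> (slope K I i)) \<le> (\<Sum>l<m. 2 * spectral_mean \<psi> (f l) + 4 * (r \<one> - r (u l)))"
    by (intro sum_mono)
  also have "\<dots> = 2 * spectral_mean \<psi> (\<lambda>\<theta>. \<Sum>l<m. f l \<theta>) + (\<Sum>l<m. 4 * (r \<one> - r (u l)))"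
    by (simp add: sum.distrib sum_distrib_left spectral_mean_sum[OF ev f])
  also have "spectral_mean \<psi> (\<lambda>\<theta>. \<Sum>l<m. f l \<theta>) \<le> spectral_mean \<psi> (\<lambda>\<theta>. 2 + c * weight \<theta> i)"
  proof (rule spectral_mean_mono[OF ev pd])
    show "cos_poly (\<lambda>\<theta>. \<Sum>l<m. f l \<theta>)" by (intro cos_poly_sum f)
    show "cos_poly (\<lambda>\<theta>. 2 + c * weight \<theta> i)"
      by (intro cos_poly_add cos_poly_cmult cos_poly_const cos_poly_weight)
    show "(\<Sum>l<m. f l \<theta>) \<le> 2 + c * weight \<theta> i" for \<theta>
      using sum_slope_shear[OF id m, of K \<theta>] id by (simp add: f_def dual_action_shear c_def)
  qed
  also have "spectral_mean \<psi> (\<lambda>\<theta>. 2 + c * weight \<theta> i) = 2 * r \<one> + c * spectral_mean \<psi> (\<lambda>\<theta>. weight \<theta> i)"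
    using spectral_mean_add[OF ev cos_poly_const cos_poly_cmult[OF cos_poly_weight], of 2 c i]
    by (simp add: spectral_mean_const[OF ev] spectral_mean_cmult[OF ev cos_poly_weight]) (simp add: \<psi>_def)
  finally show ?thesis by (simp add: \<psi>_def[abs_def] c_def)
qed

lemma spectral_mean_weight:
  assumes "real_pd_on G r"
  shows "spectral_mean (\<lambda>k. r (\<iota> k)) (\<lambda>\<theta>. weight \<theta> i) = (r \<one> - r (\<iota> (axis i 1))) / (2 * real CARD('n))"
proof -
  note ev = even_restriction[OF assms]
  have eq: "(\<lambda>\<theta> :: 'n \<Rightarrow> real. weight \<theta> i) = (\<lambda>\<theta>. 1 / (2 * real CARD('n)) * (1 - cos (pairing (axis i 1) \<theta>)))"
    by (simp add: weight_def chord_power2 fun_eq_iff field_simps)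
  show ?thesis
    unfolding eq
    by (simp only: spectral_mean_cmult[OF ev] spectral_mean_diff[OF ev] spectral_mean_const[OF ev]
        spectral_mean_cos[OF ev] cos_poly_diff cos_poly_const cos_poly_cos) simp
qed

lemma spectral_mean_average_kernel:
  assumes "real_pd_on G r"
  shows "spectral_mean (\<lambda>k. r (\<iota> k)) (average_kernel N d)
    = (\<Sum>k<N. \<Sum>l<N. r (\<iota> (axis d (int k - int l)))) / (real N)\<^sup>2"
proof -
  note ev = even_restriction[OF assms]
  have eq: "average_kernel N d = (\<lambda>\<theta>. 1 / (real N)\<^sup>2 * (\<Sum>k<N. \<Sum>l<N. cos (pairing (axis d (int k - int l)) \<theta>)))"
    by (simp add: average_kernel_def fun_eq_iff)
  show ?thesis
    unfolding eq
    by (simp only: spectral_mean_cmult[OF ev] spectral_mean_sum[OF ev] cos_poly_sum cos_poly_cos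
        spectral_mean_cos[OF ev]) simp
qed

text \<open>As \<open>K\<close> grows, \<open>(1 - total_weight I \<theta>) ^ K\<close> decreases to the indicator function of the points with
  \<open>\<theta> i \<in> 2 \<pi> \<int>\<close> for all \<open>i \<in> I\<close>: this set is a null set of the spectral measure.\<close>

lemma spectral_mean_power_small:
  assumes r: "real_pd_on G r" and d: "d \<in> I" and "\<epsilon> > 0"
    and c0: "\<And>\<epsilon>. \<epsilon> > 0 \<Longrightarrow> finite {z. \<bar>r (\<iota> (axis d z))\<bar> \<ge> \<epsilon>}"
  obtains K where "spectral_mean (\<lambda>k. r (\<iota> k)) (\<lambda>\<theta>. (1 - total_weight I \<theta>) ^ K) < \<epsilon>"
proof -
  note ev = even_restriction[OF r] and pd = positive_definite_restriction[OF r]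
  \<comment> \<open>The kernel enters with the factor 4, so \<epsilon> / 8 leaves half of \<epsilon>
    for \<open>q ^ K\<close>.\<close>
  obtain N where N: "N \<ge> 1" "(\<Sum>k<N. \<Sum>l<N. r (\<iota> (axis d (int k - int l)))) / (real N)\<^sup>2 < \<epsilon> / 8"
    using double_average_small[OF c0, of "\<epsilon> / 8"] \<open>\<epsilon> > 0\<close> by auto
  define q where "q = 1 - 1 / (4 * real CARD('n) * (real N)\<^sup>2)"
  have "1 * 1 \<le> real CARD('n) * (real N)\<^sup>2"
    using N by (intro mult_mono) (simp_all add: one_le_power Suc_leI)
  then have q: "0 \<le> q" "q < 1" using N by (simp_all add: q_def)
  have "(\<lambda>K. q ^ K * r \<one>) \<longlonglongrightarrow> 0 * r \<one>"
    using q by (intro tendsto_intros LIMSEQ_realpow_zero)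
  then have "\<forall>\<^sub>F K in sequentially. q ^ K * r \<one> < \<epsilon> / 2"
    using \<open>\<epsilon> > 0\<close> by (intro order_tendstoD) auto
  then obtain K where K: "q ^ K * r \<one> < \<epsilon> / 2"
    by (meson eventually_happens trivial_limit_sequentially)
  have ak: "cos_poly (\<lambda>\<theta>. 4 * average_kernel N d \<theta>)"
    by (intro cos_poly_cmult cos_poly_average_kernel)
  have "spectral_mean (\<lambda>k. r (\<iota> k)) (\<lambda>\<theta>. (1 - total_weight I \<theta>) ^ K)
      \<le> spectral_mean (\<lambda>k. r (\<iota> k)) (\<lambda>\<theta>. 4 * average_kernel N d \<theta> + q ^ K)"
    unfolding q_def
    by (intro spectral_mean_mono ev pd power_one_minus_total_weight_le d N cos_poly_add ak cos_poly_const
        cos_poly_power cos_poly_diff cos_poly_total_weight)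
  also have "\<dots> = 4 * spectral_mean (\<lambda>k. r (\<iota> k)) (average_kernel N d) + q ^ K * r \<one>"
    by (simp add: spectral_mean_add[OF ev ak cos_poly_const] spectral_mean_cmult[OF ev cos_poly_average_kernel]
        spectral_mean_const[OF ev])
  also have "\<dots> < \<epsilon>" unfolding spectral_mean_average_kernel[OF r] using N(2) K by linarith
  finally show thesis by (rule that)
qed

text \<open>The condition on the zero entries says that A preserves the sublattice spanned by the
  axes in \<open>I\<close>, so that the angles in \<open>I\<close> are transformed among themselves.
  The shears confine these angles to the axis \<open>d\<close>, and the nonzero entry moves that
  axis.\<close>

theorem not_haagerup_property:
  assumes inj: "inj \<iota>"
    and d: "d \<in> I" and i: "i \<in> I - {d}"
    and h: "h \<in> carrier G" "\<And>k. h \<otimes> \<iota> k = \<iota> (A *v k) \<otimes> h"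
    and A: "A $ d $ i \<noteq> 0" "\<And>k j. k \<notin> I \<Longrightarrow> j \<in> I \<Longrightarrow> A $ k $ j = 0"
    and shears: "\<And>i j. i \<in> I - {d} \<Longrightarrow>
      \<exists>u\<in>carrier G. \<forall>k. u \<otimes> \<iota> k = \<iota> (shear i d j *v k) \<otimes> u"
  shows "\<not> haagerup_property G"
proof
  assume "haagerup_property G"
  then obtain \<phi> :: "nat \<Rightarrow> 'a \<Rightarrow> complex" where pd\<phi>: "\<And>n. positive_definite G (\<phi> n)"
    and c0\<phi>: "\<And>n. c0_on (carrier G) (\<phi> n)" and lim\<phi>: "\<And>g. g \<in> carrier G \<Longrightarrow> (\<lambda>n. \<phi> n g) \<longlonglongrightarrow> 1"
    unfolding haagerup_property_def by auto
  define r where "r n g = (Re (\<phi> n g) + Re (\<phi> n (inv g))) / 2" for n g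
  have r: "real_pd_on G (r n)" for n
    unfolding r_def[abs_def] by (rule real_pd_on_symmetrization[OF is_group pd\<phi>])
  have r_lim: "(\<lambda>n. r n g) \<longlonglongrightarrow> 1" if "g \<in> carrier G" for g
  proof -
    have "(\<lambda>n. (Re (\<phi> n g) + Re (\<phi> n (inv g))) / 2) \<longlonglongrightarrow> (Re 1 + Re 1) / 2"
      using that by (intro tendsto_intros lim\<phi> inv_closed) simp_all
    then show ?thesis by (simp add: r_def)
  qed
  have c0: "finite {z. \<bar>r n (\<iota> (axis d z))\<bar> \<ge> \<epsilon>}" if "\<epsilon> > 0" for \<epsilon> n
  proof -
    define P where "P = {g \<in> carrier G. cmod (\<phi> n g) \<ge> \<epsilon>}"
    have P: "finite P" using c0\<phi>[of n] that by (simp add: c0_on_def P_def)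
    have inj2: "inj (\<lambda>z. \<iota> (axis d z))" "inj (\<lambda>z. \<iota> (axis d (- z)))"
      by (auto intro!: injI simp: inj_eq[OF inj] axis_eq_axis)
    \<comment> \<open>By the symmetrization, a large value at z forces a large value of
      \<open>\<phi> n\<close> at z or at -z; injectivity leaves finitely many such z.\<close>
    have "{z. \<bar>r n (\<iota> (axis d z))\<bar> \<ge> \<epsilon>}
        \<subseteq> (\<lambda>z. \<iota> (axis d z)) -` P \<union> (\<lambda>z. \<iota> (axis d (- z))) -` P"
    proof
      fix z assume "z \<in> {z. \<bar>r n (\<iota> (axis d z))\<bar> \<ge> \<epsilon>}"
      moreover have "\<iota> (axis d (- z)) = inv (\<iota> (axis d z))"
      proof -
        have "axis d (- z) = - axis d z" by (simp add: axis_def vec_eq_iff)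
        then show ?thesis by (simp add: \<iota>_minus)
      qed
      ultimately have "\<epsilon> \<le> \<bar>Re (\<phi> n (\<iota> (axis d z))) + Re (\<phi> n (\<iota> (axis d (- z))))\<bar> / 2"
        by (simp add: r_def)
      also have "\<dots> \<le> (cmod (\<phi> n (\<iota> (axis d z))) + cmod (\<phi> n (\<iota> (axis d (- z))))) / 2"
        by (intro divide_right_mono order_trans[OF abs_triangle_ineq] add_mono abs_Re_le_cmod) simp
      finally have le: "\<epsilon> \<le> (cmod (\<phi> n (\<iota> (axis d z))) + cmod (\<phi> n (\<iota> (axis d (- z))))) / 2" .
      show "z \<in> (\<lambda>z. \<iota> (axis d z)) -` P \<union> (\<lambda>z. \<iota> (axis d (- z))) -` P"
      proof (rule ccontr)
        assume "z \<notin> (\<lambda>z. \<iota> (axis d z)) -` P \<union> (\<lambda>z. \<iota> (axis d (- z))) -` P"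
        then have "cmod (\<phi> n (\<iota> (axis d z))) < \<epsilon>" "cmod (\<phi> n (\<iota> (axis d (- z)))) < \<epsilon>"
          by (simp_all add: P_def)
        with le show False by simp
      qed
    qed
    then show ?thesis
      by (rule finite_subset) (intro finite_UnI finite_vimageI P inj2)
  qed
  define L where "L n f = spectral_mean (\<lambda>k. r n (\<iota> k)) f" for n f
  obtain C where C: "C \<ge> 0" "\<And>K \<theta>. 1 - (1 - total_weight I \<theta>) ^ K
      \<le> C * ((\<Sum>k\<in>I - {d}. slope K I k \<theta>) + slope K I i (dual_action A \<theta>)) + C * total_weight I \<theta>"
    using slope_dual_action_bound[OF d i A] by blast
  obtain u where u: "\<And>k j. k \<in> I - {d} \<Longrightarrow> u k j \<in> carrier G"
    "\<And>k j v. k \<in> I - {d} \<Longrightarrow> u k j \<otimes> \<iota> v = \<iota> (shear k d j *v v) \<otimes> u k j"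
    using shears by metis
  \<comment> \<open>In the limit every slope has mean at most 4 / m. These means enter once for each
    coordinate other than \<open>d\<close>, and twice more through A; m is chosen to push C times
    their total below 1 / 4.\<close>
  obtain m :: nat where m: "real m > max 1 (4 * C * (real (card (I - {d})) * 4 + 8))"
    using reals_Archimedean2 by blast
  then have m1: "m \<ge> 1" "real m > 0" by auto
  define B where "B k n = (2 * (2 * r n \<one> + 64 * real m ^ 5 * real CARD('n) * L n (\<lambda>\<theta>. weight \<theta> k))
      + (\<Sum>l<m. 4 * (r n \<one> - r n (u k (- int (4 * m * l)))))) / real m" for k n
  have slope_B: "L n (slope K I k) \<le> B k n" if "k \<in> I - {d}" for n K k
    using spectral_mean_slope_le[of "r n" k d I m "\<lambda>l. u k (- int (4 * m * l))" K, OF r] that d m1 u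
    by (auto simp: B_def L_def pos_le_divide_eq mult.commute)
  have L_weight: "(\<lambda>n. L n (\<lambda>\<theta>. weight \<theta> k)) \<longlonglongrightarrow> 0" for k
  proof -
    have "(\<lambda>n. (r n \<one> - r n (\<iota> (axis k 1))) / (2 * real CARD('n))) \<longlonglongrightarrow> (1 - 1) / (2 * real CARD('n))"
      by (intro tendsto_intros r_lim) simp_all
    then show ?thesis by (simp add: L_def spectral_mean_weight[OF r])
  qed
  have B_lim: "(\<lambda>n. B k n) \<longlonglongrightarrow> 4 / real m" if "k \<in> I - {d}" for k
  proof -
    have "(\<lambda>n. B k n) \<longlonglongrightarrow> (2 * (2 * 1 + 64 * real m ^ 5 * real CARD('n) * 0) + (\<Sum>l<m. 4 * (1 - 1))) / real m"
      unfolding B_def using m1 u that by (intro tendsto_intros r_lim L_weight) auto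
    then show ?thesis by simp
  qed
  \<comment> \<open>\<open>D n\<close> is free of K, so that n can be fixed before K.\<close>
  define D where "D n = C * ((\<Sum>k\<in>I - {d}. B k n) + (2 * B i n + 4 * (r n \<one> - r n h)))
      + C * (\<Sum>k\<in>I. L n (\<lambda>\<theta>. weight \<theta> k))" for n
  have key: "r n \<one> - L n (\<lambda>\<theta>. (1 - total_weight I \<theta>) ^ K) \<le> D n" for n K
  proof -
    note ev = even_restriction[OF r[of n]] and pd = positive_definite_restriction[OF r[of n]]
    have cp: "cos_poly (\<lambda>\<theta>. \<Sum>k\<in>I - {d}. slope K I k \<theta>)" "cos_poly (\<lambda>\<theta>. slope K I i (dual_action A \<theta>))"
      "cos_poly (\<lambda>\<theta>. (1 - total_weight I \<theta>) ^ K)"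
      by (rule cos_poly_sum, rule cos_poly_slope)
         (rule cos_poly_dual_action, rule cos_poly_slope,
          rule cos_poly_power, rule cos_poly_diff, rule cos_poly_const, rule cos_poly_total_weight)
    have "r n \<one> - L n (\<lambda>\<theta>. (1 - total_weight I \<theta>) ^ K) = L n (\<lambda>\<theta>. 1 - (1 - total_weight I \<theta>) ^ K)"
      unfolding L_def by (simp add: spectral_mean_diff[OF ev cos_poly_const cp(3)] spectral_mean_const[OF ev])
    also have "\<dots> \<le> L n (\<lambda>\<theta>. C * ((\<Sum>k\<in>I - {d}. slope K I k \<theta>) + slope K I i (dual_action A \<theta>))
        + C * total_weight I \<theta>)"
      unfolding L_def
      by (intro spectral_mean_mono ev pd C(2) cos_poly_add cos_poly_cmult cp cos_poly_diff cos_poly_const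
          cos_poly_total_weight)
    also have "\<dots> = C * (L n (\<lambda>\<theta>. \<Sum>k\<in>I - {d}. slope K I k \<theta>) + L n (\<lambda>\<theta>. slope K I i (dual_action A \<theta>)))
        + C * L n (total_weight I)"
      unfolding L_def
      by (simp only: spectral_mean_cmult[OF ev cos_poly_add[OF cp(1,2)]] spectral_mean_add[OF ev cp(1,2)]
          spectral_mean_cmult[OF ev cos_poly_total_weight]
          spectral_mean_add[OF ev cos_poly_cmult[OF cos_poly_add[OF cp(1,2)]] cos_poly_cmult[OF cos_poly_total_weight]])
    also have "L n (\<lambda>\<theta>. \<Sum>k\<in>I - {d}. slope K I k \<theta>) = (\<Sum>k\<in>I - {d}. L n (slope K I k))"
      unfolding L_def by (rule spectral_mean_sum[OF ev cos_poly_slope])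
    also have "L n (total_weight I) = (\<Sum>k\<in>I. L n (\<lambda>\<theta>. weight \<theta> k))"
      unfolding L_def total_weight_def[abs_def] by (rule spectral_mean_sum[OF ev cos_poly_weight])
    finally have 1: "r n \<one> - L n (\<lambda>\<theta>. (1 - total_weight I \<theta>) ^ K)
        \<le> C * ((\<Sum>k\<in>I - {d}. L n (slope K I k)) + L n (\<lambda>\<theta>. slope K I i (dual_action A \<theta>)))
          + C * (\<Sum>k\<in>I. L n (\<lambda>\<theta>. weight \<theta> k))" .
    have "L n (\<lambda>\<theta>. slope K I i (dual_action A \<theta>)) \<le> 2 * L n (slope K I i) + 4 * (r n \<one> - r n h)"
      unfolding L_def using i
      by (intro spectral_mean_almost_invariant r h cos_poly_slope slope_nonneg slope_le_1) auto
    also have "\<dots> \<le> 2 * B i n + 4 * (r n \<one> - r n h)" using slope_B[OF i] by simp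
    finally have "(\<Sum>k\<in>I - {d}. L n (slope K I k)) + L n (\<lambda>\<theta>. slope K I i (dual_action A \<theta>))
        \<le> (\<Sum>k\<in>I - {d}. B k n) + (2 * B i n + 4 * (r n \<one> - r n h))"
      by (intro add_mono sum_mono slope_B)
    from mult_left_mono[OF this C(1)] 1 show ?thesis unfolding D_def by linarith
  qed
  have "D \<longlonglongrightarrow> C * ((\<Sum>k\<in>I - {d}. 4 / real m) + (2 * (4 / real m) + 4 * (1 - 1))) + C * (\<Sum>k\<in>I. 0)"
    unfolding D_def[abs_def] by (intro tendsto_intros B_lim r_lim L_weight h i) simp_all
  also have "C * ((\<Sum>k\<in>I - {d}. 4 / real m) + (2 * (4 / real m) + 4 * (1 - 1))) + C * (\<Sum>k\<in>I. 0)
      = C * (real (card (I - {d})) * 4 + 8) / real m"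
    using m1 by (simp add: field_simps)
  finally have D_lim: "D \<longlonglongrightarrow> C * (real (card (I - {d})) * 4 + 8) / real m" .
  have "C * (real (card (I - {d})) * 4 + 8) / real m < 1 / 4"
    using m m1 by (simp add: divide_less_eq)
  from order_tendstoD(2)[OF D_lim this] order_tendstoD(1)[OF r_lim[OF one_closed], of "3 / 4"]
  have "\<forall>\<^sub>F n in sequentially. D n < 1 / 4 \<and> 3 / 4 < r n \<one>"
    by (intro eventually_conj) simp_all
  from eventually_happens'[OF sequentially_bot this]
  obtain n where n: "D n < 1 / 4" "3 / 4 < r n \<one>" by blast
  \<comment> \<open>Now \<open>r n \<one>\<close> would be less than 1 / 4 + 1 / 4, although it
    exceeds 3 / 4.\<close>
  obtain K where "L n (\<lambda>\<theta>. (1 - total_weight I \<theta>) ^ K) < 1 / 4"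
    unfolding L_def using spectral_mean_power_small[OF r[of n] d _ c0, of "1 / 4"] by auto
  with key[of n K] n show False by linarith
qed

end

section \<open>Maximality\<close>

lemma shear_upper_triangular:
  assumes "(i, d) \<in> {(1, 2), (1, 3), (2, 3 :: 3)}"
  shows "shear i d j \<in> upper_triangular_SL3Z"
  using assms unfolding mem_upper_triangular_SL3Z shear_def insert_iff empty_iff prod.inject
  by (elim disjE conjE FalseE; hypsubst; simp)

theorem proposition2p20:
  shows "maximal_haagerup_subgroup
    (carrier (semidirect_product Z3 (SL3Z\<lparr>carrier := upper_triangular_SL3Z\<rparr>) matrix_vector_mult))
    (semidirect_product Z3 SL3Z matrix_vector_mult)"
  unfolding maximal_haagerup_subgroup_def
proof (intro conjI notI haagerup_subgroup_affine_upper_triangular)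
  assume "\<exists>K. haagerup_subgroup K affine_SL3Z \<and> affine_upper_triangular \<subset> K"
  then obtain K where K: "subgroup K affine_SL3Z" "haagerup_property (affine_SL3Z\<lparr>carrier := K\<rparr>)"
    and sub: "affine_upper_triangular \<subset> K"
    unfolding haagerup_subgroup_def by blast
  let ?G = "affine_SL3Z\<lparr>carrier := K\<rparr>"
  define \<iota> :: "int ^ 3 \<Rightarrow> (int ^ 3) \<times> (int ^ 3 ^ 3)" where "\<iota> k = (k, mat 1)" for k
  have one: "mat 1 \<in> upper_triangular_SL3Z"
    using subgroup.one_closed[OF subgroup_upper_triangular_SL3Z] by (simp add: SL3Z_simps)
  have upper_K: "(v, B) \<in> K" if "B \<in> upper_triangular_SL3Z" for v B
  proof -
    have "(v, B) \<in> affine_upper_triangular" using that by simp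
    then show ?thesis using sub by blast
  qed
  interpret lattice_in_group ?G \<iota>
  proof (rule lattice_in_group.intro)
    show "group ?G" using K(1) group_Z3_SL3Z subgroup.subgroup_is_group by blast
    show "lattice_in_group_axioms ?G \<iota>"
      by unfold_locales (simp_all add: \<iota>_def upper_K one)
  qed
  obtain p where "p \<in> K" "p \<notin> affine_upper_triangular" using sub by blast
  then obtain v A where vA: "(v, A) \<in> K" "(v, A) \<notin> affine_upper_triangular" by (cases p) simp
  have not_upper: "A \<notin> upper_triangular_SL3Z" using vA(2) by simp
  have "(v, A) \<in> carrier affine_SL3Z"
    using vA(1) subgroup.subset[OF K(1)] by blast
  then have "det A = 1" by simp
  \<comment> \<open>The larger subgroup contains all translations, so the translation part of the
    new element can be removed.\<close>
  have "(- v, mat 1) \<otimes>\<^bsub>affine_SL3Z\<^esub> (v, A) \<in> K"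
    using subgroup.m_closed[OF K(1) upper_K[OF one] vA(1)] .
  then have h: "(0, A) \<in> carrier ?G" by simp
  have conj: "(0, B) \<otimes>\<^bsub>?G\<^esub> \<iota> k = \<iota> (B *v k) \<otimes>\<^bsub>?G\<^esub> (0, B)" for B k
    by (simp add: \<iota>_def)
  have shears: "\<exists>u\<in>carrier ?G. \<forall>k. u \<otimes>\<^bsub>?G\<^esub> \<iota> k = \<iota> (shear i d j *v k) \<otimes>\<^bsub>?G\<^esub> u"
    if "(i, d) \<in> {(1, 2), (1, 3), (2, 3 :: 3)}" for i d j
    by (intro bexI[of _ "(0, shear i d j)"] allI conj) (simp add: upper_K[OF shear_upper_triangular[OF that]])
  have inj: "inj \<iota>" by (simp add: inj_def \<iota>_def)
  have "\<not> haagerup_property ?G"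
  proof (cases "A $ 3 $ 1 = 0 \<and> A $ 3 $ 2 = 0")
    case True
    \<comment> \<open>\<open>A\<close> need not move the last coordinate axis of the dual torus, but it preserves the sublattice
      \<open>\<int>\<^sup>2 \<times> 0\<close> and moves the second axis of the dual torus of that.\<close>
    show ?thesis
    proof (rule not_haagerup_property[OF inj _ _ h conj])
      show "A $ 2 $ 1 \<noteq> 0"
        using not_upper \<open>det A = 1\<close> True by (simp add: upper_triangular_SL3Z_def SL3Z_def)
      show "(2 :: 3) \<in> {1, 2}" "(1 :: 3) \<in> {1, 2} - {2}" by simp_all
      show "A $ k $ j = 0" if "k \<notin> {1, 2}" "j \<in> {1, 2}" for k j
      proof -
        have "k = 3" using that(1) exhaust_3[of k] by blast
        then show ?thesis using that(2) True by blast
      qed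
      fix i :: 3 and j assume "i \<in> {1, 2} - {2}"
      then have "i = 1" by blast
      then show "\<exists>u\<in>carrier ?G. \<forall>k. u \<otimes>\<^bsub>?G\<^esub> \<iota> k = \<iota> (shear i 2 j *v k) \<otimes>\<^bsub>?G\<^esub> u"
        by (intro shears) blast
    qed
  next
    case False
    \<comment> \<open>Here A moves the third axis of the dual torus, and all three angles are
      used.\<close>
    then obtain i where i: "i = 1 \<or> i = 2" "A $ 3 $ i \<noteq> 0" by blast
    show ?thesis
    proof (rule not_haagerup_property[OF inj _ _ h conj])
      show "A $ 3 $ i \<noteq> 0" by fact
      show "(3 :: 3) \<in> UNIV" by simp
      show "i \<in> UNIV - {3}" using i(1) by (elim disjE) simp_all
      show "A $ k $ j = 0" if "k \<notin> UNIV" for k j using that by simp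
      fix i' :: 3 and j assume "i' \<in> UNIV - {3}"
      then have "i' = 1 \<or> i' = 2" using exhaust_3[of i'] by blast
      then show "\<exists>u\<in>carrier ?G. \<forall>k. u \<otimes>\<^bsub>?G\<^esub> \<iota> k = \<iota> (shear i' 3 j *v k) \<otimes>\<^bsub>?G\<^esub> u"
        by (intro shears) blast
    qed
  qed
  then show False using K(2) by contradiction
qed

end
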